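(* Let $X=X_V$ be a multivariate time series with index set $V=\{1,\dots,d\}$ that, in the idle regime $\sigma_a(t)=\emptyset$, satisfies the global Granger-causal Markov property with respect to a mixed graph $G=(V,E)$. Let $a,b\in S\subseteq V$, let $t\in\mathbb{Z}$, and let $\sigma_a(t)$ be the intervention indicator for $X_a(t)$, taking the value $\emptyset$ or the value $s$ (an atomic, conditional or random intervention). Suppose that (1) $(\overline{X}_V(t-1),X_{V\setminus\{a\}}(t))\perp\!\!\!\perp\sigma_a(t)$; (2) $\{X_V(t+j): j\in\mathbb{N}\}\perp\!\!\!\perp\sigma_a(t)\mid\overline{X}_V(t)$; (3) if $s$ is a conditional intervention, or a random intervention whose distribution depends on the past $\overline{X}_C(t-1)$ of components $C\subseteq V$, then $C\subseteq S$. If all $\mathrm{an}(b)$-pointing back-door paths between $a$ and $\mathrm{an}(b)$ in $G$ are $m$-blocked given $S$, then the assumptions of the back-door identification criterion are satisfied, i.e., in addition to (1)–(3), $$X_b(t+h)\perp\!\!\!\perp\sigma_a(t)\mid\overline{X}_S(t)\qquad\text{for all }h\in\mathbb{N}.$$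
   Context: Time series. $X=\{X(t),t\in\mathbb{Z}\}$, $X(t)=(X_1(t),\dots,X_d(t))'$, is (in the idle regime) a stationary, mixing stochastic process whose conditional distributions $\mathbb{P}(X(t+1)\mid\overline{X}(t))$ have regular, almost surely absolutely continuous versions. For $A\subseteq V$, $X_A$ is the subprocess with components $X_a$, $a\in A$, and $\overline{X}_A(t)=\{X_A(u):u\le t\}$. $\mathbb{N}=\{1,2,\dots\}$. Regimes. $\sigma_a(t)$ is not a random variable; it is a parameter indexing the different joint distributions of $X$ under the regimes considered. $\sigma_a(t)=\emptyset$ is the idle (observational) regime, in which $X_a(t)$ arises without intervention. $\sigma_a(t)=s$ is one of the following. - Atomic intervention, $s=x^*$ in the domain of $X_a(t)$: the conditional law of $X_a(t)$ given $\overline{X}_V(t-1)$ is the point mass at $x^*$. - Conditional intervention, $s=g$, a function of $\overline{x}_C(t-1)$ for some $C\subset V$: the conditional law of $X_a(t)$ given $\overline{X}_V(t-1)$ is the point mass at $g(\overline{X}_C(t-1))$. - Random intervention: the conditional law of $X_a(t)$ given $\overline{X}_V(t-1)$ is a known distribution, possibly a function of $\overline{X}_C(t-1)$ for some $C\subseteq V$. Independence of $\sigma$. $Y\perp\!\!\!\perp\sigma_a(t)$ means that the distribution of $Y$ is the same under all regimes considered. $Y\perp\!\!\!\perp\sigma_a(t)\mid Z$ means that the conditional distribution of $Y$ given $Z$ is the same under all regimes considered, i.e. there is one version of it valid under every regime. Graphs. A mixed graph $G=(V,E)$ has directed edges $u\to v$ and undirected (dashed) edges $u\,\text{---}\,v$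 between distinct nodes; several edges between two nodes are allowed if they differ in type or orientation (so up to three). A path from $u$ to $v$ is a sequence $(e_1,\dots,e_n)$ of not necessarily distinct edges such that $e_i$ is an edge between $v_{i-1}$ and $v_i$ for some not necessarily distinct vertices $v_0=u,v_1,\dots,v_n=v$. It is $v$-pointing if $e_n=v_{n-1}\to v$, and bi-pointing if $e_1=u\leftarrow v_1$ and $e_n=v_{n-1}\to v$. A path is $B$-pointing if it is $b'$-pointing for some $b'\in B$ that is its final endpoint. A path from $u$ is a front-door path if $e_1=u\to v_1$; otherwise (i.e. $e_1$ is $u\leftarrow v_1$ or $u\,\text{---}\,v_1$) it is a back-door path. A path between $a$ and a set $B$ is a path from $a$ to some element of $B$. A node $u$ is an ancestor of $v$ if $u=v$ or there is a directed path $u\to\cdots\to v$; $\mathrm{an}(v)$ is the set of all ancestors of $v$ (so $v\in\mathrm{an}(v)$). $m$-blocking. An intermediate vertex $c$ at a given position on a path is an $m$-collider if the preceding and succeeding edges both have an arrowhead or a dashed tail at $c$ ($\to c\leftarrow$, $\text{---}\,c\,\text{---}$, $\text{---}\,c\leftarrow$, $\to c\,\text{---}$); otherwise it is an $m$-non-collider. Endpoints are neither; a vertex visited several times may have different status at different positions. A path is $m$-connecting given $S$ if every $m$-non-collider on it is not in $S$ and every $m$-collider on it is in $S$; otherwise it is $m$-blocked given $S$. Global Granger-causal Markov property of $X$ with respect to $G$. For all disjoint $A,B,C\subseteq V$: (i) if every $B$-pointing path between $A$ and $B$ is $m$-blocked given $B\cup C$, then $X_A$ is Granger-noncausal for $X_B$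 with respect to $X_{A\cup B\cup C}$, i.e. $X_B(u+1)\perp\!\!\!\perp\overline{X}_A(u)\mid\overline{X}_{B\cup C}(u)$ for all $u\in\mathbb{Z}$; (ii) if every bi-pointing path between $A$ and $B$ is $m$-blocked given $A\cup B\cup C$ and there is no undirected edge between $A$ and $B$, then $X_A$ and $X_B$ are contemporaneously independent with respect to $X_{A\cup B\cup C}$, i.e. $X_A(u+1)\perp\!\!\!\perp X_B(u+1)\mid\overline{X}_{A\cup B\cup C}(u)$ for all $u\in\mathbb{Z}$.
   Formalization: For random interventions two assumptions are added: given the past, the drawn X_a(t) is independent of the simultaneous X_{V∖{a}}(t); and, off an idle-null event about the past of X_S up to t, events about the past of X_V up to t that are null in the idle regime are null under s. *)

theory Defs
  imports "HOL-Probability.Probability"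
begin

section \<open>Mixed graphs and m-blocking\<close>

text \<open>
  The vertex set is the whole (finite) type \<open>'v\<close>. At most one directed edge per orientation and
  one undirected edge join two vertices, so edges are two relations on distinct vertices.
\<close>

record 'v mixed_graph =
  directed :: "('v \<times> 'v) set"
  undirected :: "('v \<times> 'v) set"

definition mixed_graph :: "'v mixed_graph \<Rightarrow> bool" where
  "mixed_graph G \<longleftrightarrow>
     irrefl (directed G) \<and> irrefl (undirected G) \<and> sym (undirected G)"

definition an :: "'v mixed_graph \<Rightarrow> 'v \<Rightarrow> 'v set" where
  "an G v = {u. (u, v) \<in> (directed G)\<^sup>*}"

text \<open>
  A step \<open>(x, k, y)\<close> traverses one edge from \<open>x\<close> to \<open>y\<close>: \<open>Fwd\<close> is an edge from \<open>x\<close> into \<open>y\<close>, \<open>Bwd\<close> an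
  edge from \<open>y\<close> into \<open>x\<close>, and \<open>Und\<close> an undirected edge. Paths may repeat vertices and edges.
\<close>

datatype kind = Fwd | Bwd | Und

type_synonym 'v step = "'v \<times> kind \<times> 'v"

abbreviation kind_of :: "'v step \<Rightarrow> kind" where
  "kind_of e \<equiv> fst (snd e)"

abbreviation target :: "'v step \<Rightarrow> 'v" where
  "target e \<equiv> snd (snd e)"

fun is_step :: "'v mixed_graph \<Rightarrow> 'v step \<Rightarrow> bool" where
  "is_step G (x, Fwd, y) \<longleftrightarrow> (x, y) \<in> directed G"
| "is_step G (x, Bwd, y) \<longleftrightarrow> (y, x) \<in> directed G"
| "is_step G (x, Und, y) \<longleftrightarrow> (x, y) \<in> undirected G"

fun is_path :: "'v mixed_graph \<Rightarrow> 'v \<Rightarrow> 'v step list \<Rightarrow> 'v \<Rightarrow> bool" where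
  "is_path G u [] v \<longleftrightarrow> u = v"
| "is_path G u ((x, k, y) # es) v \<longleftrightarrow> x = u \<and> is_step G (x, k, y) \<and> is_path G y es v"

text \<open>\<open>pointing\<close> means pointing to the final endpoint of the path.\<close>

definition pointing :: "'v step list \<Rightarrow> bool" where
  "pointing es \<longleftrightarrow> es \<noteq> [] \<and> kind_of (last es) = Fwd"

definition bi_pointing :: "'v step list \<Rightarrow> bool" where
  "bi_pointing es \<longleftrightarrow> es \<noteq> [] \<and> kind_of (hd es) = Bwd \<and> kind_of (last es) = Fwd"

definition back_door :: "'v step list \<Rightarrow> bool" where
  "back_door es \<longleftrightarrow> es \<noteq> [] \<and> kind_of (hd es) \<noteq> Fwd"

text \<open>
  Position \<open>i\<close> is the intermediate vertex between steps \<open>i\<close> and \<open>i + 1\<close>; it is a collider if both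
  steps have an arrowhead or a dashed tail there.
\<close>

definition m_collider :: "'v step list \<Rightarrow> nat \<Rightarrow> bool" where
  "m_collider es i \<longleftrightarrow>
     kind_of (es ! i) \<in> {Fwd, Und} \<and> kind_of (es ! Suc i) \<in> {Bwd, Und}"

definition m_connecting :: "'v set \<Rightarrow> 'v step list \<Rightarrow> bool" where
  "m_connecting S es \<longleftrightarrow>
     (\<forall>i. Suc i < length es \<longrightarrow>
        (m_collider es i \<longrightarrow> target (es ! i) \<in> S) \<and>
        (\<not> m_collider es i \<longrightarrow> target (es ! i) \<notin> S))"

definition m_blocked :: "'v set \<Rightarrow> 'v step list \<Rightarrow> bool" where
  "m_blocked S es \<longleftrightarrow> \<not> m_connecting S es"


section \<open>Time series\<close>

text \<open>
  For a set \<open>J\<close> of (component, time) pairs, \<open>obs X J\<close> is the family of the corresponding variables,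
  with values in \<open>path_space J\<close>. Thus the past of \<open>X\<^sub>A\<close> up to time \<open>t\<close> is \<open>obs X (A \<times> {..t})\<close>.
\<close>

abbreviation path_space :: "('v \<times> int) set \<Rightarrow> ('v \<times> int \<Rightarrow> real) measure" where
  "path_space J \<equiv> (\<Pi>\<^sub>M j\<in>J. borel)"

definition obs :: "('v \<Rightarrow> int \<Rightarrow> 'w \<Rightarrow> real) \<Rightarrow> ('v \<times> int) set \<Rightarrow> 'w \<Rightarrow> ('v \<times> int \<Rightarrow> real)" where
  "obs X J \<omega> = (\<lambda>(c, u)\<in>J. X c u \<omega>)"

definition time_series :: "'w measure \<Rightarrow> ('v \<Rightarrow> int \<Rightarrow> 'w \<Rightarrow> real) \<Rightarrow> bool" where
  "time_series M X \<longleftrightarrow> prob_space M \<and> (\<forall>c u. X c u \<in> borel_measurable M)"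

definition generated :: "'w measure \<Rightarrow> ('w \<Rightarrow> 'z) \<Rightarrow> 'z measure \<Rightarrow> 'w measure" where
  "generated M Z L = vimage_algebra (space M) Z L"

text \<open>
  \<open>cond_dist M Y N Z L \<kappa>\<close>: the kernel \<open>\<kappa>\<close> is a (regular) version of the conditional distribution
  of \<open>Y\<close> (with values in \<open>N\<close>) given \<open>Z\<close> (with values in \<open>L\<close>) under \<open>M\<close>.
\<close>

definition cond_dist ::
  "'w measure \<Rightarrow> ('w \<Rightarrow> 'y) \<Rightarrow> 'y measure \<Rightarrow> ('w \<Rightarrow> 'z) \<Rightarrow> 'z measure \<Rightarrow> ('z \<Rightarrow> 'y measure) \<Rightarrow> bool"
where
  "cond_dist M Y N Z L \<kappa> \<longleftrightarrow>
     \<kappa> \<in> L \<rightarrow>\<^sub>M prob_algebra N \<and>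
     (\<forall>A\<in>sets N. AE \<omega> in M.
        real_cond_exp M (generated M Z L) (indicator (Y -` A \<inter> space M)) \<omega> = measure (\<kappa> (Z \<omega>)) A)"

text \<open>\<open>cond_indep M X I J K\<close>: given \<open>obs X K\<close>, the families \<open>obs X I\<close> and \<open>obs X J\<close> are independent.\<close>

definition cond_indep ::
  "'w measure \<Rightarrow> ('v \<Rightarrow> int \<Rightarrow> 'w \<Rightarrow> real) \<Rightarrow>
     ('v \<times> int) set \<Rightarrow> ('v \<times> int) set \<Rightarrow> ('v \<times> int) set \<Rightarrow> bool"
where
  "cond_indep M X I J K \<longleftrightarrow>
     (\<forall>A \<in> sets (generated M (obs X I) (path_space I)).
      \<forall>B \<in> sets (generated M (obs X J) (path_space J)).
        let F = generated M (obs X K) (path_space K) in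
        AE \<omega> in M. real_cond_exp M F (indicator (A \<inter> B)) \<omega> =
          real_cond_exp M F (indicator A) \<omega> * real_cond_exp M F (indicator B) \<omega>)"

definition lagged :: "int \<Rightarrow> ('v \<Rightarrow> int \<Rightarrow> 'w \<Rightarrow> real) \<Rightarrow> 'v \<Rightarrow> int \<Rightarrow> 'w \<Rightarrow> real" where
  "lagged k X c u = X c (u + k)"

definition stationary :: "'w measure \<Rightarrow> ('v \<Rightarrow> int \<Rightarrow> 'w \<Rightarrow> real) \<Rightarrow> bool" where
  "stationary M X \<longleftrightarrow>
     (\<forall>k. distr M (path_space UNIV) (obs (lagged k X) UNIV) = distr M (path_space UNIV) (obs X UNIV))"

text \<open>Mixing in the sense of ergodic theory, the weakest of the usual (strong) mixing notions.\<close>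

definition mixing :: "'w measure \<Rightarrow> ('v \<Rightarrow> int \<Rightarrow> 'w \<Rightarrow> real) \<Rightarrow> bool" where
  "mixing M X \<longleftrightarrow>
     (\<forall>A\<in>sets (path_space UNIV). \<forall>B\<in>sets (path_space UNIV).
       (\<lambda>n. measure M {\<omega> \<in> space M. obs X UNIV \<omega> \<in> A \<and> obs (lagged (int n) X) UNIV \<omega> \<in> B})
         \<longlonglongrightarrow> measure M {\<omega> \<in> space M. obs X UNIV \<omega> \<in> A} * measure M {\<omega> \<in> space M. obs X UNIV \<omega> \<in> B})"

definition ac_conditionals :: "'w measure \<Rightarrow> ('v \<Rightarrow> int \<Rightarrow> 'w \<Rightarrow> real) \<Rightarrow> bool" where
  "ac_conditionals M X \<longleftrightarrow>
     (\<forall>u. \<exists>\<kappa>.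
        cond_dist M (obs X (UNIV \<times> {u + 1})) (path_space (UNIV \<times> {u + 1}))
          (obs X (UNIV \<times> {..u})) (path_space (UNIV \<times> {..u})) \<kappa> \<and>
        (AE \<omega> in M. absolutely_continuous (\<Pi>\<^sub>M j\<in>UNIV \<times> {u + 1}. lborel) (\<kappa> (obs X (UNIV \<times> {..u}) \<omega>))))"

definition granger_noncausal ::
  "'w measure \<Rightarrow> ('v \<Rightarrow> int \<Rightarrow> 'w \<Rightarrow> real) \<Rightarrow> 'v set \<Rightarrow> 'v set \<Rightarrow> 'v set \<Rightarrow> bool" where
  "granger_noncausal M X A B C \<longleftrightarrow>
     (\<forall>u. cond_indep M X (B \<times> {u + 1}) (A \<times> {..u}) ((B \<union> C) \<times> {..u}))"

definition contemp_independent ::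
  "'w measure \<Rightarrow> ('v \<Rightarrow> int \<Rightarrow> 'w \<Rightarrow> real) \<Rightarrow> 'v set \<Rightarrow> 'v set \<Rightarrow> 'v set \<Rightarrow> bool" where
  "contemp_independent M X A B C \<longleftrightarrow>
     (\<forall>u. cond_indep M X (A \<times> {u + 1}) (B \<times> {u + 1}) ((A \<union> B \<union> C) \<times> {..u}))"

definition global_granger_markov ::
  "'w measure \<Rightarrow> ('v \<Rightarrow> int \<Rightarrow> 'w \<Rightarrow> real) \<Rightarrow> 'v mixed_graph \<Rightarrow> bool" where
  "global_granger_markov M X G \<longleftrightarrow>
     (\<forall>A B C. A \<inter> B = {} \<and> A \<inter> C = {} \<and> B \<inter> C = {} \<longrightarrow>
       ((\<forall>x\<in>A. \<forall>y\<in>B. \<forall>es. is_path G x es y \<and> pointing es \<longrightarrow> m_blocked (B \<union> C) es) \<longrightarrow>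
          granger_noncausal M X A B C) \<and>
       ((\<forall>x\<in>A. \<forall>y\<in>B. \<forall>es. is_path G x es y \<and> bi_pointing es \<longrightarrow> m_blocked (A \<union> B \<union> C) es) \<and>
        (\<forall>x\<in>A. \<forall>y\<in>B. (x, y) \<notin> undirected G) \<longrightarrow>
          contemp_independent M X A B C))"


section \<open>Interventions and regimes\<close>

text \<open>
  The set argument is the set \<open>C\<close> of components on whose past the prescribed value or the prescribed
  distribution of \<open>X\<^sub>a(t)\<close> depends; \<open>C = {}\<close> is a random intervention with a fixed distribution.
\<close>

datatype 'v intervention =
    Atomic real
  | Conditional "'v set" "('v \<times> int \<Rightarrow> real) \<Rightarrow> real"
  | Random "'v set" "('v \<times> int \<Rightarrow> real) \<Rightarrow> real measure"

fun depends_on :: "'v intervention \<Rightarrow> 'v set" where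
  "depends_on (Atomic x) = {}"
| "depends_on (Conditional C g) = C"
| "depends_on (Random C q) = C"

datatype 'v regime = Idle | Do "'v intervention"

definition cond_law_given_past ::
  "'w measure \<Rightarrow> ('v \<Rightarrow> int \<Rightarrow> 'w \<Rightarrow> real) \<Rightarrow> 'v \<Rightarrow> int \<Rightarrow>
     (('v \<times> int \<Rightarrow> real) \<Rightarrow> real measure) \<Rightarrow> bool" where
  "cond_law_given_past M X a t \<kappa> \<longleftrightarrow>
     cond_dist M (X a t) borel (obs X (UNIV \<times> {..t - 1})) (path_space (UNIV \<times> {..t - 1})) \<kappa>"

text \<open>
  \<open>M\<close> is the law under the intervention on \<open>X\<^sub>a(t)\<close>. In a random intervention the value is drawn by
  external randomisation from the prescribed distribution: given the past, the draw is independent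
  of the simultaneous values of the other components. For the other two kinds of intervention this
  independence holds automatically, the conditional law being a point mass.
\<close>

fun intervened ::
  "'w measure \<Rightarrow> ('v \<Rightarrow> int \<Rightarrow> 'w \<Rightarrow> real) \<Rightarrow> 'v \<Rightarrow> int \<Rightarrow> 'v intervention \<Rightarrow> bool" where
  "intervened M X a t (Atomic x) \<longleftrightarrow>
     cond_law_given_past M X a t (\<lambda>_. return borel x)"
| "intervened M X a t (Conditional C g) \<longleftrightarrow>
     g \<in> borel_measurable (path_space (C \<times> {..t - 1})) \<and>
     cond_law_given_past M X a t (\<lambda>p. return borel (g (restrict p (C \<times> {..t - 1}))))"
| "intervened M X a t (Random C q) \<longleftrightarrow>
     q \<in> path_space (C \<times> {..t - 1}) \<rightarrow>\<^sub>M prob_algebra borel \<and>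
     cond_law_given_past M X a t (\<lambda>p. q (restrict p (C \<times> {..t - 1}))) \<and>
     cond_indep M X {(a, t)} ((- {a}) \<times> {t}) (UNIV \<times> {..t - 1})"

text \<open>
  Overlap (positivity) of the idle law \<open>M\<close> and the interventional law \<open>M'\<close>: apart from an event about
  the past of \<open>X\<^sub>S\<close> up to \<open>t\<close> that is null in the idle regime, an event about the past of \<open>X\<close> up to
  \<open>t\<close> that is null in the idle regime is also null under the intervention. If the dependence set of
  the intervention is contained in \<open>S\<close> and \<open>a \<in> S\<close>, this is automatic for atomic and conditional
  interventions (the event that \<open>X\<^sub>a(t)\<close> takes the prescribed value is exceptional), and for random
  ones it follows from positivity of the idle conditional densities. Without it, versions of
  conditional distributions given the past of \<open>X\<close> are unconstrained on the interventional histories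
  that are impossible in the idle regime.
\<close>

definition overlap ::
  "'w measure \<Rightarrow> 'w measure \<Rightarrow> ('v \<Rightarrow> int \<Rightarrow> 'w \<Rightarrow> real) \<Rightarrow> 'v set \<Rightarrow> int \<Rightarrow> bool" where
  "overlap M M' X S t \<longleftrightarrow>
     (\<exists>N \<in> sets (path_space (S \<times> {..t})).
        (AE \<omega> in M. obs X (S \<times> {..t}) \<omega> \<notin> N) \<and>
        (\<forall>E \<in> sets (path_space (UNIV \<times> {..t})).
           (AE \<omega> in M. obs X (UNIV \<times> {..t}) \<omega> \<notin> E) \<longrightarrow>
           (AE \<omega> in M'. obs X (UNIV \<times> {..t}) \<omega> \<in> E \<longrightarrow> obs X (S \<times> {..t}) \<omega> \<in> N)))"

text \<open>
  Independence of \<open>Y\<close> from the (non-random) intervention indicator, marginally and given \<open>Z\<close>; \<open>P\<close>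
  assigns to each regime its law and \<open>R\<close> is the set of regimes considered.
\<close>

definition indep_regime ::
  "('r \<Rightarrow> 'w measure) \<Rightarrow> 'r set \<Rightarrow> ('w \<Rightarrow> 'y) \<Rightarrow> 'y measure \<Rightarrow> bool" where
  "indep_regime P R Y N \<longleftrightarrow> (\<forall>r\<in>R. \<forall>r'\<in>R. distr (P r) N Y = distr (P r') N Y)"

definition cond_indep_regime ::
  "('r \<Rightarrow> 'w measure) \<Rightarrow> 'r set \<Rightarrow> ('w \<Rightarrow> 'y) \<Rightarrow> 'y measure \<Rightarrow> ('w \<Rightarrow> 'z) \<Rightarrow> 'z measure \<Rightarrow> bool" where
  "cond_indep_regime P R Y N Z L \<longleftrightarrow> (\<exists>\<kappa>. \<forall>r\<in>R. cond_dist (P r) Y N Z L \<kappa>)"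

end

theory Submission
  imports Defs
begin

text \<open>
  Let \<open>A\<close> be the set of ancestors of \<open>b\<close> and \<open>U = A - S\<close>. The hypothesis implies that no back-door
  path from \<open>a\<close> to \<open>U\<close> is \<open>m\<close>-connecting given \<open>S\<close>, since such a path could be prolonged inside \<open>A\<close>. Let
  \<open>T \<subseteq> S\<close> consist of \<open>a\<close> and of the vertices of \<open>S\<close> that an \<open>m\<close>-connecting back-door path from \<open>a\<close> enters
  with an arrowhead or a dashed tail. The Markov property gives
  \<open>X\<^sub>T(t) \<bottom> past of X\<^sub>U | past of X\<^sub>S\<close> and \<open>X\<^sub>T(t) \<bottom> X\<^bsub>U \<union> (S - T)\<^esub>(t) | past of X\<^bsub>S \<union> U\<^esub>\<close>, hence, in the
  idle regime, \<open>X\<^sub>a(t)\<close> is independent of \<open>X\<^sub>U\<close> up to \<open>t\<close> given the other variables of \<open>X\<^sub>S\<close> up to \<open>t\<close>.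
  Under a random intervention the same holds because the distribution that is drawn from depends only on
  the past of \<open>X\<^sub>S\<close>. Consequently, off an exceptional event \<open>N\<close> about \<open>X\<^sub>S\<close> up to \<open>t\<close>, the interventional
  law of \<open>X\<^bsub>S \<union> U\<^esub>\<close> up to \<open>t\<close> has a density with respect to the idle law that is a function of \<open>X\<^sub>S\<close> up to
  \<open>t\<close> alone. As \<open>X\<^sub>b(t + h)\<close> depends on the past only through \<open>X\<^sub>A\<close>, the idle conditional distribution
  given \<open>X\<^sub>S\<close> up to \<open>t\<close> remains valid off \<open>N\<close>. Since \<open>N\<close> is null in the idle regime, the interventional
  version can be used on \<open>N\<close>. For atomic and conditional interventions, \<open>N\<close> is the event that
  \<open>X\<^sub>a(t)\<close> takes the prescribed value, and nothing happens off \<open>N\<close>.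
\<close>


section \<open>Back-door paths\<close>

lemma m_connecting_single [simp]: "m_connecting S [e]"
  by (simp add: m_connecting_def)

text \<open>Shifting positions by one turns the position-wise definition into a recursion on the
  list. Its two implications at a vertex merge into one equivalence: in \<open>S\<close> exactly
  when a collider.\<close>

lemma m_connecting_Cons_Cons:
  "m_connecting S (e # e' # es) \<longleftrightarrow>
     (target e \<in> S \<longleftrightarrow> kind_of e \<in> {Fwd, Und} \<and> kind_of e' \<in> {Bwd, Und}) \<and> m_connecting S (e' # es)"
  (is "_ \<longleftrightarrow> ?junction \<and> _")
proof -
  have "m_connecting S (e # e' # es) \<longleftrightarrow>
      (\<forall>i. i < Suc (length es) \<longrightarrow> (target ((e # e' # es) ! i) \<in> S \<longleftrightarrow> m_collider (e # e' # es) i))"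
    unfolding m_connecting_def by auto
  also have "\<dots> \<longleftrightarrow> ?junction \<and>
      (\<forall>i. i < length es \<longrightarrow> (target ((e' # es) ! i) \<in> S \<longleftrightarrow> m_collider (e' # es) i))"
    unfolding less_Suc_eq_0_disj by (auto simp: m_collider_def)
  also have "(\<forall>i. i < length es \<longrightarrow> (target ((e' # es) ! i) \<in> S \<longleftrightarrow> m_collider (e' # es) i)) \<longleftrightarrow>
      m_connecting S (e' # es)"
    unfolding m_connecting_def by auto
  finally show ?thesis .
qed

lemma m_connecting_append:
  assumes "es \<noteq> []" "fs \<noteq> []"
  shows "m_connecting S (es @ fs) \<longleftrightarrow> m_connecting S es \<and> m_connecting S fs \<and>
    (target (last es) \<in> S \<longleftrightarrow> kind_of (last es) \<in> {Fwd, Und} \<and> kind_of (hd fs) \<in> {Bwd, Und})"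
  using assms
proof (induction es rule: induct_list012)
  case (2 e)
  then obtain f fs' where "fs = f # fs'" by (cases fs) auto
  then show ?case by (auto simp: m_connecting_Cons_Cons)
qed (auto simp: m_connecting_Cons_Cons)

lemma is_path_append: "is_path G u (es @ fs) v \<longleftrightarrow> (\<exists>w. is_path G u es w \<and> is_path G w fs v)"
  by (induction es arbitrary: u) auto

lemma is_path_target_last: "is_path G u es v \<Longrightarrow> es \<noteq> [] \<Longrightarrow> target (last es) = v"
  by (induction es arbitrary: u) (auto split: if_splits)

fun flip :: "kind \<Rightarrow> kind" where
  "flip Fwd = Bwd" | "flip Bwd = Fwd" | "flip Und = Und"

fun flip_step :: "'v step \<Rightarrow> 'v step" where
  "flip_step (x, k, y) = (y, flip k, x)"

definition rev_path :: "'v step list \<Rightarrow> 'v step list" where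
  "rev_path es = rev (map flip_step es)"

lemma is_path_rev:
  assumes "mixed_graph G" "is_path G u es v"
  shows "is_path G v (rev_path es) u"
  using assms(2)
proof (induction es arbitrary: u)
  case (Cons e es)
  obtain x k y where "e = (x, k, y)" by (cases e)
  with Cons assms(1) show ?case
    by (cases k) (auto simp: rev_path_def is_path_append mixed_graph_def dest: symD)
qed (simp add: rev_path_def)

text \<open>The collider condition at a vertex is symmetric in its two edges, and reversal swaps
  these. The path hypothesis matters because a reversed step ends where the original step starts,
  which is the target of the preceding step only on a genuine path.\<close>

lemma m_connecting_rev:
  assumes "is_path G u es v" "m_connecting S es"
  shows "m_connecting S (rev_path es)"
  using assms
proof (induction es arbitrary: u rule: induct_list012)
  case (3 e f es)
  obtain x k y k' z where e: "e = (x, k, y)" and f: "f = (y, k', z)"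
    using 3(3) by (cases e; cases f) auto
  have *: "m_connecting S (rev_path (f # es))"
    using 3 e by (auto simp: m_connecting_Cons_Cons)
  have **: "rev_path (e # f # es) = rev_path (f # es) @ [flip_step e]"
    by (simp add: rev_path_def)
  have l: "last (rev_path (f # es)) = flip_step f" "rev_path (f # es) \<noteq> []"
    by (simp_all add: rev_path_def)
  show ?case
    using 3(4) * l unfolding ** unfolding e f
    by (cases k; cases k') (auto simp: m_connecting_append m_connecting_Cons_Cons)
qed (auto simp: rev_path_def m_connecting_def)

lemma hd_rev_path: "es \<noteq> [] \<Longrightarrow> kind_of (hd (rev_path es)) = flip (kind_of (last es))"
  by (cases "last es") (simp add: rev_path_def hd_rev last_map)

lemma rev_path_Nil [simp]: "rev_path es = [] \<longleftrightarrow> es = []"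
  by (simp add: rev_path_def)

text \<open>Adding \<open>U\<close> to the conditioning set changes the requirement only at vertices
  of \<open>U\<close>. So cut the path at its first intermediate visit to \<open>U\<close>, if there
  is one; up to there both sets impose the same requirement. The common first step ensures that a
  prefix of a back-door path is one too.\<close>

lemma m_connecting_Un_prefix:
  assumes "is_path G u es v" "es \<noteq> []" "m_connecting (S \<union> U) es"
  obtains "m_connecting S es"
    | fs w where "is_path G u fs w" "fs \<noteq> []" "hd fs = hd es" "w \<in> U" "m_connecting S fs"
  using assms
proof (induction es arbitrary: v thesis rule: rev_induct)
  case (snoc e es)
  show ?case
  proof (cases "es = []")
    case True
    then show ?thesis using snoc.prems(1) by simp
  next
    case False
    obtain w where w: "is_path G u es w" using snoc.prems(3) by (auto simp: is_path_append)
    have wt: "target (last es) = w" using is_path_target_last[OF w False] .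
    have c: "m_connecting (S \<union> U) es" using snoc.prems(5) False by (simp add: m_connecting_append)
    show ?thesis
    proof (rule snoc.IH[OF _ _ w False c])
      assume S: "m_connecting S es"
      show ?thesis
      proof (cases "w \<in> U")
        case True
        show ?thesis by (rule snoc.prems(2)[OF w False _ True S]) (simp add: False)
      next
        case False
        then show ?thesis
          using snoc.prems(1,5) S wt \<open>es \<noteq> []\<close> by (simp add: m_connecting_append)
      qed
    next
      fix fs w' assume "is_path G u fs w'" "fs \<noteq> []" "hd fs = hd es" "w' \<in> U" "m_connecting S fs"
      then show ?thesis using snoc.prems(2)[of fs w'] False by simp
    qed
  qed
qed simp

text \<open>
  A back-door path of this kind can be prolonged by every path that leaves \<open>v\<close> against an arrow or along
  an undirected edge, since \<open>v \<in> S\<close> is then a collider.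
\<close>

definition collider_reachable :: "'v mixed_graph \<Rightarrow> 'v set \<Rightarrow> 'v \<Rightarrow> 'v set" where
  "collider_reachable G S a = insert a {v \<in> S. \<exists>es. is_path G a es v \<and> back_door es \<and>
     m_connecting S es \<and> kind_of (last es) \<in> {Fwd, Und}}"

lemma collider_reachable_extend:
  assumes v: "v \<in> collider_reachable G S a"
    and es: "is_path G v es w" "back_door es" "m_connecting S es"
  obtains fs where "is_path G a fs w" "back_door fs" "m_connecting S fs" "last fs = last es"
proof (cases "v = a")
  case True
  then show ?thesis using es that by blast
next
  case False
  then obtain gs where gs: "v \<in> S" "is_path G a gs v" "back_door gs" "m_connecting S gs"
      "kind_of (last gs) \<in> {Fwd, Und}"
    using v by (auto simp: collider_reachable_def)
  have ne: "gs \<noteq> []" "es \<noteq> []" using gs es by (auto simp: back_door_def)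
  have "kind_of (hd es) \<in> {Bwd, Und}"
    using es(2) by (cases "kind_of (hd es)") (auto simp: back_door_def)
  then have "m_connecting S (gs @ es)"
    using gs es ne is_path_target_last[OF gs(2) ne(1)] by (simp add: m_connecting_append)
  moreover have "is_path G a (gs @ es) w" using gs es by (auto simp: is_path_append)
  moreover have "back_door (gs @ es)" using gs ne by (simp add: back_door_def)
  ultimately show ?thesis using that[of "gs @ es"] ne by simp
qed

section \<open>Consequences of the blocking hypothesis\<close>

context
  fixes G :: "'v mixed_graph" and S :: "'v set" and a b :: 'v
  assumes G: "mixed_graph G" and aS: "a \<in> S" and bS: "b \<in> S"
    and blocked: "\<forall>v\<in>an G b. \<forall>es. is_path G a es v \<and> pointing es \<and> back_door es \<longrightarrow> m_blocked S es"
begin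

text \<open>As \<open>b \<in> S\<close>, a vertex \<open>u\<close> of \<open>an G b - S\<close> has
  an edge into a further ancestor of \<open>b\<close>. Appended to the path, this edge has its tail
  at \<open>u\<close>, so \<open>u\<close> becomes a non-collider outside \<open>S\<close>, and the
  longer path contradicts \<open>blocked\<close>.\<close>

lemma no_back_door_path_to_ancestor:
  assumes "is_path G a es u" "back_door es" "m_connecting S es"
  shows "u \<notin> an G b - S"
proof
  assume u: "u \<in> an G b - S"
  then have "u \<noteq> b" using bS by auto
  then obtain c where c: "(u, c) \<in> directed G" "c \<in> an G b"
    using u by (auto simp: an_def elim: converse_rtranclE)
  have ne: "es \<noteq> []" using assms by (auto simp: back_door_def)
  have "m_connecting S (es @ [(u, Fwd, c)])"
    using assms u ne is_path_target_last[OF assms(1) ne] by (simp add: m_connecting_append)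
  moreover have "is_path G a (es @ [(u, Fwd, c)]) c" using assms c by (auto simp: is_path_append)
  moreover have "pointing (es @ [(u, Fwd, c)])" "back_door (es @ [(u, Fwd, c)])"
    using assms ne by (auto simp: pointing_def back_door_def)
  ultimately show False using blocked c(2) unfolding m_blocked_def by blast
qed

text \<open>After prolonging to a path from \<open>a\<close>, a target in \<open>S\<close> reached
  with an arrowhead or a dashed tail belongs to \<open>collider_reachable G S a\<close> by
  definition, and a target in \<open>an G b - S\<close> is impossible.\<close>

lemma no_back_door_path_from_collider_reachable:
  assumes "v \<in> collider_reachable G S a" "is_path G v es w" "back_door es" "m_connecting S es"
    and "kind_of (last es) \<in> {Fwd, Und}"
  shows "w \<notin> (an G b - S) \<union> (S - collider_reachable G S a)"
proof -
  obtain fs where fs: "is_path G a fs w" "back_door fs" "m_connecting S fs" "last fs = last es"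
    using collider_reachable_extend[OF assms(1-4)] .
  then show ?thesis
    using no_back_door_path_to_ancestor[OF fs(1-3)] assms(5) by (auto simp: collider_reachable_def)
qed

text \<open>Read backwards, a path pointing to \<open>v\<close> leaves \<open>v\<close> against an
  arrow, so it starts at \<open>a\<close> itself or prolongs a path from \<open>a\<close> through
  the collider \<open>v\<close>. This serves the Granger-noncausality part of the Markov
  property.\<close>

lemma pointing_into_collider_reachable_blocked:
  assumes "u \<in> an G b - S" "v \<in> collider_reachable G S a" "is_path G u es v" "pointing es"
  shows "m_blocked S es"
proof (rule ccontr)
  assume "\<not> ?thesis"
  then have "m_connecting S (rev_path es)"
    using m_connecting_rev[OF assms(3)] by (simp add: m_blocked_def)
  moreover have "back_door (rev_path es)"
    using assms(4) by (simp add: back_door_def pointing_def hd_rev_path)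
  moreover note is_path_rev[OF G assms(3)]
  ultimately obtain fs where "is_path G a fs u" "back_door fs" "m_connecting S fs"
    using collider_reachable_extend[OF assms(2)] by metis
  then show False using no_back_door_path_to_ancestor assms(1) by blast
qed

text \<open>Contemporaneous independence will be used given the past of \<open>an G b - S\<close> as
  well. A path that is connecting given the larger set is connecting given \<open>S\<close>, or a
  prefix of it reaches \<open>an G b - S\<close> and is connecting given \<open>S\<close>; both are
  excluded.\<close>

lemma bi_pointing_collider_reachable_blocked:
  assumes v: "v \<in> collider_reachable G S a"
    and w: "w \<in> (an G b - S) \<union> (S - collider_reachable G S a)"
    and es: "is_path G v es w" "bi_pointing es"
  shows "m_blocked (S \<union> (an G b - S)) es"
proof (rule ccontr)
  assume "\<not> ?thesis"
  then have c: "m_connecting (S \<union> (an G b - S)) es" by (simp add: m_blocked_def)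
  have ne: "es \<noteq> []" and bd: "back_door es" and l: "kind_of (last es) = Fwd"
    using es(2) by (auto simp: bi_pointing_def back_door_def)
  show False
  proof (rule m_connecting_Un_prefix[OF es(1) ne c])
    assume "m_connecting S es"
    then show False
      using no_back_door_path_from_collider_reachable[OF v es(1) bd] w l by blast
  next
    fix fs x
    assume fs: "is_path G v fs x" "fs \<noteq> []" "hd fs = hd es" "x \<in> an G b - S" "m_connecting S fs"
    then have "back_door fs" using bd by (simp add: back_door_def)
    then obtain gs where "is_path G a gs x" "back_door gs" "m_connecting S gs"
      using collider_reachable_extend[OF v fs(1)] fs(5) by metis
    then show False using no_back_door_path_to_ancestor fs(4) by blast
  qed
qed

text \<open>An undirected edge alone is a back-door path that ends in a dashed tail, and without
  intermediate vertices nothing can block it.\<close>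

lemma no_undirected_from_collider_reachable:
  assumes "v \<in> collider_reachable G S a" "w \<in> (an G b - S) \<union> (S - collider_reachable G S a)"
  shows "(v, w) \<notin> undirected G"
proof
  assume "(v, w) \<in> undirected G"
  then have "is_path G v [(v, Und, w)] w" "back_door [(v, Und, w)]"
    by (auto simp: back_door_def)
  then show False
    using no_back_door_path_from_collider_reachable[OF assms(1)] assms(2) by fastforce
qed

end

text \<open>The last edge \<open>x \<rightarrow> v\<close> makes \<open>x\<close> an ancestor too.
  Hence \<open>x\<close> differs from \<open>u\<close> and is intermediate, and the tail at
  \<open>x\<close> makes it a non-collider in the conditioning set.\<close>

lemma pointing_to_ancestors_blocked:
  assumes "u \<notin> an G b" "v \<in> an G b" "is_path G u es v" "pointing es"
  shows "m_blocked (an G b) es"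
proof (rule ccontr)
  assume "\<not> ?thesis"
  then have c: "m_connecting (an G b) es" by (simp add: m_blocked_def)
  obtain fs x k y where es: "es = fs @ [(x, k, y)]"
    using assms(4) by (cases es rule: rev_cases) (auto simp: pointing_def)
  have k: "k = Fwd" "y = v" using assms es by (auto simp: pointing_def is_path_append)
  have x: "(x, v) \<in> directed G" "is_path G u fs x"
    using assms(3) k es by (auto simp: is_path_append)
  then have xan: "x \<in> an G b" using assms(2) by (auto simp: an_def intro: converse_rtrancl_into_rtrancl)
  then have ne: "fs \<noteq> []" using x assms(1) by auto
  then show False
    using c xan is_path_target_last[OF x(2) ne] k es by (simp add: m_connecting_append)
qed


section \<open>Conditional independence of families of variables\<close>

text \<open>Dynkin's argument: the sets on which the integrals agree contain \<open>E\<close>, and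
  they are closed under complements, because \<open>space M \<in> E\<close>, and under countable
  disjoint unions.\<close>

lemma set_integral_eq_on_sigma_sets:
  fixes f g :: "'a \<Rightarrow> real"
  assumes f: "integrable M f" and g: "integrable M g"
    and E: "Int_stable E" "E \<subseteq> sets M" "space M \<in> E"
    and eq: "\<And>D. D \<in> E \<Longrightarrow> (LINT x:D|M. f x) = (LINT x:D|M. g x)"
    and D: "D \<in> sigma_sets (space M) E"
  shows "(LINT x:D|M. f x) = (LINT x:D|M. g x)"
proof -
  have Pow: "E \<subseteq> Pow (space M)" using E(2) sets.sets_into_space by auto
  have sub: "sigma_sets (space M) E \<subseteq> sets M" by (rule sets.sigma_sets_subset[OF E(2)])
  have int: "set_integrable M A f" "set_integrable M A g" if "A \<in> sigma_sets (space M) E" for A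
    using that sub f g unfolding set_integrable_def by (auto simp del: real_scaleR_def intro: integrable_mult_indicator)
  show ?thesis
    using E(1) Pow D
  proof (induction rule: sigma_sets_induct_disjoint)
    case (basic A) then show ?case by (rule eq)
  next
    case empty show ?case by (simp add: set_lebesgue_integral_def)
  next
    case (compl A)
    have A: "A \<in> sets M" using compl(1) sub by auto
    have *: "(LINT x:space M - A|M. h x) = (LINT x:space M|M. h x) - (LINT x:A|M. h x)"
      if "integrable M h" for h :: "'a \<Rightarrow> real"
    proof -
      have "(LINT x:space M - A|M. h x) = (LINT x|M. indicator (space M) x *\<^sub>R h x - indicator A x *\<^sub>R h x)"
        unfolding set_lebesgue_integral_def
        by (intro Bochner_Integration.integral_cong) (auto simp: indicator_def)
      also have "\<dots> = (LINT x:space M|M. h x) - (LINT x:A|M. h x)"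
        unfolding set_lebesgue_integral_def
        by (intro Bochner_Integration.integral_diff integrable_mult_indicator that A) auto
      finally show ?thesis .
    qed
    show ?case using compl(2) eq[OF E(3)] by (simp add: *[OF f] *[OF g])
  next
    case (union A)
    have A: "A i \<in> sets M" for i using union(2) sub by auto
    have U: "(\<Union>i. A i) \<in> sigma_sets (space M) E" using union(2) by (auto intro: sigma_sets.Union)
    show ?case
      using union A int[OF U]
      by (simp add: lebesgue_integral_countable_add[of A] disjoint_family_on_def)
  qed
qed

section \<open>Information generated by subfamilies of the variables\<close>

abbreviation info :: "'w measure \<Rightarrow> ('v \<Rightarrow> int \<Rightarrow> 'w \<Rightarrow> real) \<Rightarrow> ('v \<times> int) set \<Rightarrow> 'w measure" where
  "info M X J \<equiv> generated M (obs X J) (path_space J)"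

lemma obs_in_path_space: "obs X J \<omega> \<in> space (path_space J)"
  by (simp add: obs_def space_PiM)

lemma sets_info: "sets (info M X J) = {obs X J -` A \<inter> space M | A. A \<in> sets (path_space J)}"
  unfolding generated_def by (rule sets_vimage_algebra2) (simp add: obs_in_path_space)

lemma space_info [simp]: "space (info M X J) = space M"
  by (simp add: generated_def)

lemma measurable_obs_info: "obs X J \<in> info M X J \<rightarrow>\<^sub>M path_space J"
  unfolding generated_def by (rule measurable_vimage_algebra1) (simp add: obs_in_path_space)

lemma measurable_obs [measurable]: "time_series M X \<Longrightarrow> obs X J \<in> M \<rightarrow>\<^sub>M path_space J"
  unfolding obs_def by (auto simp: time_series_def intro!: measurable_restrict)

lemma restrict_obs: "I \<subseteq> J \<Longrightarrow> restrict (obs X J \<omega>) I = obs X I \<omega>"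
  by (auto simp: obs_def restrict_def fun_eq_iff)

lemma obs_apply: "(c, u) \<in> J \<Longrightarrow> obs X J \<omega> (c, u) = X c u \<omega>"
  by (simp add: obs_def)

text \<open>The product algebra is generated by conditions on single coordinates, and preimages
  commute with generating a sigma-algebra. In this form monotonicity in \<open>J\<close> is
  immediate.\<close>

lemma sets_info_eq_sigma_sets:
  "sets (info M X J) =
     sigma_sets (space M) {X c u -` A \<inter> space M | c u A. (c, u) \<in> J \<and> A \<in> sets borel}"
  (is "_ = sigma_sets _ ?G")
proof -
  let ?\<Omega> = "\<Pi>\<^sub>E i\<in>J. space borel :: real set"
  let ?R = "{{f \<in> ?\<Omega>. f i \<in> A} | i A. i \<in> J \<and> A \<in> sets borel}"
  have obs: "obs X J \<in> space M \<rightarrow> ?\<Omega>" using obs_in_path_space[of X J] by (auto simp: space_PiM)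
  have "sets (info M X J) = {obs X J -` A \<inter> space M | A. A \<in> sigma_sets ?\<Omega> ?R}"
    unfolding sets_info sets_PiM_single ..
  also have "\<dots> = sigma_sets (space M) {obs X J -` A \<inter> space M | A. A \<in> ?R}"
    by (rule sigma_sets_vimage_commute[OF obs])
  also have "{obs X J -` A \<inter> space M | A. A \<in> ?R} = ?G"
  proof (intro equalityI subsetI; clarify)
    fix A and i and B :: "real set"
    assume *: "i \<in> J" "B \<in> sets borel"
    obtain c u where "i = (c, u)" by (cases i)
    with * show "\<exists>c u A. obs X J -` {f \<in> ?\<Omega>. f i \<in> B} \<inter> space M = X c u -` A \<inter> space M \<and>
        (c, u) \<in> J \<and> A \<in> sets borel"
      using obs by (intro exI[of _ c] exI[of _ u] exI[of _ B]) (auto simp: obs_apply)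
  next
    fix c u and B :: "real set"
    assume *: "(c, u) \<in> J" "B \<in> sets borel"
    show "\<exists>A. X c u -` B \<inter> space M = obs X J -` A \<inter> space M \<and> A \<in> ?R"
      using * obs
      by (intro exI[of _ "{f \<in> ?\<Omega>. f (c, u) \<in> B}"]) (auto simp: obs_apply)
  qed
  finally show ?thesis .
qed

lemma info_mono: "I \<subseteq> J \<Longrightarrow> sets (info M X I) \<subseteq> sets (info M X J)"
  unfolding sets_info_eq_sigma_sets by (intro sigma_sets_mono') blast

lemma subalgebra_info_info: "I \<subseteq> J \<Longrightarrow> subalgebra (info M X J) (info M X I)"
  using info_mono[of I J M X] by (simp add: subalgebra_def)

lemma subalgebra_info: "time_series M X \<Longrightarrow> subalgebra M (info M X J)"
  unfolding subalgebra_def using measurable_sets[OF measurable_obs, of M X _ J]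
  by (auto simp: sets_info)

text \<open>Each variable of the union belongs to one of the two families, with
  \<open>space M\<close> as the trivial event of the other. The generators form a pi-system, on
  which identities for \<open>I \<union> J\<close> can be checked.\<close>

lemma sets_info_Un:
  "sets (info M X (I \<union> J)) =
     sigma_sets (space M) {A \<inter> B | A B. A \<in> sets (info M X I) \<and> B \<in> sets (info M X J)}"
  (is "_ = sigma_sets _ ?E")
proof
  have top: "space M \<in> sets (info M X K)" for K
    using sets.top[of "info M X K"] by simp
  have sub: "A \<subseteq> space M" if "A \<in> sets (info M X K)" for A K
    using sets.sets_into_space[OF that] by simp
  show "sets (info M X (I \<union> J)) \<subseteq> sigma_sets (space M) ?E"
    unfolding sets_info_eq_sigma_sets[of M X "I \<union> J"]
  proof (rule sigma_sets_mono, clarify)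
    fix c u A assume *: "(c, u) \<in> I \<union> J" "A \<in> sets (borel :: real measure)"
    let ?A = "X c u -` A \<inter> space M"
    consider "?A \<in> sets (info M X I)" | "?A \<in> sets (info M X J)"
      using * unfolding sets_info_eq_sigma_sets by (blast intro: sigma_sets.Basic)
    then have "?A \<in> ?E"
    proof cases
      case 1
      then show ?thesis using top[of J] by (intro CollectI exI[of _ ?A] exI[of _ "space M"]) auto
    next
      case 2
      then show ?thesis using top[of I] by (intro CollectI exI[of _ "space M"] exI[of _ ?A]) auto
    qed
    then show "?A \<in> sigma_sets (space M) ?E" by (rule sigma_sets.Basic)
  qed
  show "sigma_sets (space M) ?E \<subseteq> sets (info M X (I \<union> J))"
    using info_mono[of I "I \<union> J" M X] info_mono[of J "I \<union> J" M X]
      sets.sigma_sets_subset[of ?E "info M X (I \<union> J)"] by auto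
qed

lemma Int_stable_info:
  "Int_stable {A \<inter> B | A B. A \<in> sets (info M X I) \<and> B \<in> sets (info M X J)}"
proof (rule Int_stableI, clarify)
  fix A B A' B'
  assume "A \<in> sets (info M X I)" "B \<in> sets (info M X J)" "A' \<in> sets (info M X I)" "B' \<in> sets (info M X J)"
  then show "\<exists>A'' B''. A \<inter> B \<inter> (A' \<inter> B') = A'' \<inter> B'' \<and> A'' \<in> sets (info M X I) \<and> B'' \<in> sets (info M X J)"
    by (intro exI[of _ "A \<inter> A'"] exI[of _ "B \<inter> B'"]) auto
qed

lemma finite_measure_subalgebra_info:
  "time_series M X \<Longrightarrow> finite_measure_subalgebra M (info M X J)"
  unfolding finite_measure_subalgebra_def finite_measure_subalgebra_axioms_def
  using subalgebra_info by (auto simp: time_series_def prob_space_def)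

section \<open>Conditional probabilities and rules of conditional independence\<close>

context
  fixes M :: "'w measure" and X :: "'v \<Rightarrow> int \<Rightarrow> 'w \<Rightarrow> real"
  assumes ts: "time_series M X"
begin

interpretation prob_space M using ts by (simp add: time_series_def)

interpretation info: finite_measure_subalgebra M "info M X J" for J
  by (rule finite_measure_subalgebra_info[OF ts])

lemma info_sets: "A \<in> sets (info M X J) \<Longrightarrow> A \<in> sets M"
  using subalgebra_info[OF ts] by (auto simp: subalgebra_def)

abbreviation (input) cprob :: "('v \<times> int) set \<Rightarrow> 'w set \<Rightarrow> 'w \<Rightarrow> real" where
  "cprob J A \<equiv> real_cond_exp M (info M X J) (indicator A)"

lemma integrable_cprob: "A \<in> sets M \<Longrightarrow> integrable M (cprob J A)"
  by (intro info.real_cond_exp_int integrable_real_indicator) (auto simp: emeasure_eq_measure)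

lemma integrable_indicator_cprob:
  "A \<in> sets M \<Longrightarrow> B \<in> sets M \<Longrightarrow> integrable M (\<lambda>\<omega>. indicator B \<omega> * cprob J A \<omega>)"
  using integrable_mult_indicator[of B M "cprob J A"] integrable_cprob by simp

lemma cprob_nested:
  assumes "I \<subseteq> J" "A \<in> sets M"
  shows "AE \<omega> in M. real_cond_exp M (info M X I) (cprob J A) \<omega> = cprob I A \<omega>"
  using assms
  by (intro info.real_cond_exp_nested_subalg subalgebra_info[OF ts] subalgebra_info_info)
    (auto simp: emeasure_eq_measure)

lemma cprob_Int:
  assumes "A \<in> sets M" "B \<in> sets (info M X J)"
  shows "AE \<omega> in M. cprob J (A \<inter> B) \<omega> = indicator B \<omega> * cprob J A \<omega>"
proof -
  have [measurable]: "A \<in> sets M" "B \<in> sets M" using assms info_sets by auto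
  have "AE \<omega> in M. real_cond_exp M (info M X J) (\<lambda>\<omega>. indicator B \<omega> * indicator A \<omega>) \<omega> =
      indicator B \<omega> * cprob J A \<omega>"
    using assms by (intro info.real_cond_exp_mult) (auto simp: indicator_inter_arith[symmetric] emeasure_eq_measure)
  also have "(\<lambda>\<omega>. indicator B \<omega> * indicator A \<omega> :: real) = indicator (A \<inter> B)"
    by (auto simp: indicator_def)
  finally show ?thesis .
qed

lemma set_integral_cprob:
  assumes "A \<in> sets M" "D \<in> sets (info M X J)"
  shows "(LINT \<omega>:D|M. cprob J A \<omega>) = (LINT \<omega>:D|M. indicator A \<omega>)"
  using assms by (intro info.real_cond_exp_intA[symmetric]) (auto simp: emeasure_eq_measure)

lemma cprob_eqI:
  assumes "A \<in> sets M" "integrable M f" "f \<in> borel_measurable (info M X J)"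
    and "\<And>D. D \<in> sets (info M X J) \<Longrightarrow> (LINT \<omega>:D|M. indicator A \<omega>) = (LINT \<omega>:D|M. f \<omega>)"
  shows "AE \<omega> in M. cprob J A \<omega> = f \<omega>"
  using assms by (intro info.real_cond_exp_charact) (auto simp: emeasure_eq_measure)

text \<open>The asymmetric form, that \<open>J\<close> adds nothing to the prediction of
  \<open>I\<close> from \<open>K\<close>, is the one in which the rules below are proved. From the
  product form it follows by testing on events \<open>B \<inter> C\<close> and extending by the
  pi-system argument; the converse conditions first on \<open>J \<union> K\<close>, where
  \<open>B\<close> is known.\<close>

theorem cond_indep_iff:
  "cond_indep M X I J K \<longleftrightarrow>
     (\<forall>A\<in>sets (info M X I). AE \<omega> in M. cprob (J \<union> K) A \<omega> = cprob K A \<omega>)"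
proof
  assume ci: "cond_indep M X I J K"
  show "\<forall>A\<in>sets (info M X I). AE \<omega> in M. cprob (J \<union> K) A \<omega> = cprob K A \<omega>"
  proof (intro ballI cprob_eqI)
    fix A assume A: "A \<in> sets (info M X I)"
    show AM: "A \<in> sets M" using A info_sets by auto
    show "integrable M (cprob K A)" by (rule integrable_cprob[OF AM])
    show "cprob K A \<in> borel_measurable (info M X (J \<union> K))"
      by (rule measurable_from_subalg[OF subalgebra_info_info[of K]])
        (auto intro: borel_measurable_cond_exp)
    fix D assume D: "D \<in> sets (info M X (J \<union> K))"
    let ?E = "{B \<inter> C | B C. B \<in> sets (info M X J) \<and> C \<in> sets (info M X K)}"
    show "(LINT \<omega>:D|M. indicator A \<omega>) = (LINT \<omega>:D|M. cprob K A \<omega>)"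
    proof (rule set_integral_eq_on_sigma_sets[where E = ?E])
      show "integrable M (indicator A :: _ \<Rightarrow> real)" using AM by (simp add: emeasure_eq_measure)
      show "integrable M (cprob K A)" by fact
      show "Int_stable ?E" by (rule Int_stable_info)
      show "?E \<subseteq> sets M" using info_sets by auto
      have "space M \<in> sets (info M X L)" for L using sets.top[of "info M X L"] by simp
      then show "space M \<in> ?E" by blast
      show "D \<in> sigma_sets (space M) ?E" using D unfolding sets_info_Un .
      fix D' assume "D' \<in> ?E"
      then obtain B C where D': "D' = B \<inter> C" "B \<in> sets (info M X J)" "C \<in> sets (info M X K)" by auto
      have [measurable]: "A \<in> sets M" "B \<in> sets M" "C \<in> sets M" using D' info_sets AM by auto
      have "(LINT \<omega>:D'|M. indicator A \<omega>) = (LINT \<omega>:C|M. indicator (A \<inter> B) \<omega> :: real)"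
        unfolding set_lebesgue_integral_def D'
        by (intro Bochner_Integration.integral_cong) (auto simp: indicator_def)
      also have "\<dots> = (LINT \<omega>:C|M. cprob K (A \<inter> B) \<omega>)"
        using D' by (intro set_integral_cprob[symmetric]) auto
      also have "\<dots> = (LINT \<omega>:C|M. cprob K A \<omega> * cprob K B \<omega>)"
        unfolding set_lebesgue_integral_def
      proof (intro integral_cong_AE)
        show "AE \<omega> in M. indicator C \<omega> *\<^sub>R cprob K (A \<inter> B) \<omega> =
            indicator C \<omega> *\<^sub>R (cprob K A \<omega> * cprob K B \<omega>)"
          using ci[unfolded cond_indep_def Let_def, rule_format, OF A D'(2)] by eventually_elim simp
      qed (auto intro!: borel_measurable_times borel_measurable_cond_exp2)
      also have "\<dots> = (LINT \<omega>|M. (indicator C \<omega> * cprob K A \<omega>) * cprob K B \<omega>)"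
        by (simp add: set_lebesgue_integral_def mult.assoc)
      \<comment> \<open>The other factor is known given \<open>K\<close>, so under the integral the
        conditional probability of \<open>B\<close> may be replaced by its indicator.\<close>
      also have "\<dots> = (LINT \<omega>|M. (indicator C \<omega> * cprob K A \<omega>) * indicator B \<omega>)"
      proof (rule info.real_cond_exp_intg(2))
        show "integrable M (\<lambda>\<omega>. (indicator C \<omega> * cprob K A \<omega>) * indicator B \<omega>)"
          using integrable_indicator_cprob[of A "C \<inter> B" K]
          by (simp add: indicator_inter_arith mult_ac)
        show "(\<lambda>\<omega>. indicator C \<omega> * cprob K A \<omega>) \<in> borel_measurable (info M X K)"
          using D'(3) by (intro borel_measurable_times borel_measurable_cond_exp) auto
      qed auto
      also have "\<dots> = (LINT \<omega>:D'|M. cprob K A \<omega>)"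
        unfolding set_lebesgue_integral_def D'
        by (intro Bochner_Integration.integral_cong) (auto simp: indicator_def)
      finally show "(LINT \<omega>:D'|M. indicator A \<omega>) = (LINT \<omega>:D'|M. cprob K A \<omega>)" .
    qed
  qed
next
  assume *: "\<forall>A\<in>sets (info M X I). AE \<omega> in M. cprob (J \<union> K) A \<omega> = cprob K A \<omega>"
  show "cond_indep M X I J K"
    unfolding cond_indep_def Let_def
  proof (intro ballI)
    fix A B assume A: "A \<in> sets (info M X I)" and B: "B \<in> sets (info M X J)"
    have AM [measurable]: "A \<in> sets M" and BM [measurable]: "B \<in> sets M" using A B info_sets by auto
    have "B \<in> sets (info M X (J \<union> K))" using B info_mono[of J "J \<union> K"] by auto
    then have 1: "AE \<omega> in M. cprob (J \<union> K) (A \<inter> B) \<omega> = indicator B \<omega> * cprob K A \<omega>"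
      using cprob_Int[OF AM, of B "J \<union> K"] bspec[OF * A] by auto
    have "AE \<omega> in M. cprob K (A \<inter> B) \<omega> = real_cond_exp M (info M X K) (cprob (J \<union> K) (A \<inter> B)) \<omega>"
      using cprob_nested[of K "J \<union> K" "A \<inter> B"] by auto
    moreover have "AE \<omega> in M. real_cond_exp M (info M X K) (cprob (J \<union> K) (A \<inter> B)) \<omega> =
        real_cond_exp M (info M X K) (\<lambda>\<omega>. cprob K A \<omega> * indicator B \<omega>) \<omega>"
      using 1 by (intro info.real_cond_exp_cong)
        (auto intro!: borel_measurable_times borel_measurable_cond_exp2 simp: mult.commute)
    moreover have "AE \<omega> in M. real_cond_exp M (info M X K) (\<lambda>\<omega>. cprob K A \<omega> * indicator B \<omega>) \<omega> =
        cprob K A \<omega> * cprob K B \<omega>"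
      using integrable_indicator_cprob[OF AM BM]
      by (intro info.real_cond_exp_mult) (auto intro: borel_measurable_cond_exp simp: mult.commute)
    ultimately show "AE \<omega> in M. cprob K (A \<inter> B) \<omega> = cprob K A \<omega> * cprob K B \<omega>" by auto
  qed
qed

lemma cond_indep_contraction:
  assumes "cond_indep M X I J K" "cond_indep M X I J' (J \<union> K)"
  shows "cond_indep M X I (J' \<union> J) K"
  unfolding cond_indep_iff
proof
  fix A assume "A \<in> sets (info M X I)"
  then have "AE \<omega> in M. cprob (J \<union> K) A \<omega> = cprob K A \<omega>"
    "AE \<omega> in M. cprob (J' \<union> (J \<union> K)) A \<omega> = cprob (J \<union> K) A \<omega>"
    using assms unfolding cond_indep_iff by auto
  then show "AE \<omega> in M. cprob (J' \<union> J \<union> K) A \<omega> = cprob K A \<omega>"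
    by (auto simp: Un_assoc)
qed

text \<open>The semigraphoid axioms of decomposition and weak union, combined.\<close>

lemma cond_indep_between:
  assumes ci: "cond_indep M X I J K" and I': "I' \<subseteq> I"
    and sub: "K \<subseteq> K'" "K' \<subseteq> J \<union> K" "J' \<subseteq> J \<union> K"
  shows "cond_indep M X I' J' K'"
  unfolding cond_indep_iff
proof
  fix A assume "A \<in> sets (info M X I')"
  then have A: "A \<in> sets (info M X I)" using info_mono[OF I'] by auto
  have AM: "A \<in> sets M" using A info_sets by auto
  \<comment> \<open>For every family \<open>L\<close> in between, conditioning the prediction from
    \<open>J \<union> K\<close> down to \<open>L\<close> leaves it unchanged, because it almost
    surely equals a function of \<open>K\<close>.\<close>
  have *: "AE \<omega> in M. cprob L A \<omega> = cprob K A \<omega>" if "K \<subseteq> L" "L \<subseteq> J \<union> K" for L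
  proof -
    have "AE \<omega> in M. real_cond_exp M (info M X L) (cprob (J \<union> K) A) \<omega> = cprob L A \<omega>"
      by (rule cprob_nested[OF that(2) AM])
    moreover have "AE \<omega> in M. real_cond_exp M (info M X L) (cprob (J \<union> K) A) \<omega> =
        real_cond_exp M (info M X L) (cprob K A) \<omega>"
      using ci A unfolding cond_indep_iff
      by (intro info.real_cond_exp_cong) (auto intro: borel_measurable_cond_exp2)
    moreover have "AE \<omega> in M. real_cond_exp M (info M X L) (cprob K A) \<omega> = cprob K A \<omega>"
      using integrable_cprob[OF AM]
      by (intro info.real_cond_exp_F_meas measurable_from_subalg[OF subalgebra_info_info[OF that(1)]])
        (auto intro: borel_measurable_cond_exp)
    ultimately show ?thesis by auto
  qed
  show "AE \<omega> in M. cprob (J' \<union> K') A \<omega> = cprob K' A \<omega>"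
  proof -
    have "K \<subseteq> J' \<union> K'" "J' \<union> K' \<subseteq> J \<union> K" using sub by auto
    from *[OF this] *[OF sub(1,2)] show ?thesis by auto
  qed
qed

end

lemma cond_indep_sym:
  assumes "cond_indep M X I J K" shows "cond_indep M X J I K"
  unfolding cond_indep_def Let_def
proof (intro ballI)
  fix A B assume "A \<in> sets (info M X J)" "B \<in> sets (info M X I)"
  then show "AE \<omega> in M. real_cond_exp M (info M X K) (indicator (A \<inter> B)) \<omega> =
      real_cond_exp M (info M X K) (indicator A) \<omega> * real_cond_exp M (info M X K) (indicator B) \<omega>"
    using assms[unfolded cond_indep_def Let_def, rule_format, of B A]
    by (simp add: Int_commute mult.commute)
qed


section \<open>Conditional distributions\<close>

lemma sets_generated:
  "Z \<in> M \<rightarrow>\<^sub>M L \<Longrightarrow> sets (generated M Z L) = {Z -` C \<inter> space M | C. C \<in> sets L}"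
  unfolding generated_def by (rule sets_vimage_algebra2) (auto dest: measurable_space)

lemma space_generated [simp]: "space (generated M Z L) = space M"
  by (simp add: generated_def)

lemma subalgebra_generated: "Z \<in> M \<rightarrow>\<^sub>M L \<Longrightarrow> subalgebra M (generated M Z L)"
  by (auto simp: subalgebra_def sets_generated)

lemma measurable_generated: "Z \<in> M \<rightarrow>\<^sub>M L \<Longrightarrow> Z \<in> generated M Z L \<rightarrow>\<^sub>M L"
  unfolding generated_def by (rule measurable_vimage_algebra1) (auto dest: measurable_space)

text \<open>Doob-Dynkin factorisation, by induction on non-negative measurable functions: an event
  is a preimage under \<open>Z\<close>, and scaling, sums and suprema are carried out on the
  factors.\<close>

lemma borel_measurable_generated_factor:
  fixes f :: "'w \<Rightarrow> ennreal"
  assumes Z: "Z \<in> M \<rightarrow>\<^sub>M L" and f: "f \<in> borel_measurable (generated M Z L)"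
  shows "\<exists>g\<in>borel_measurable L. \<forall>\<omega>\<in>space M. f \<omega> = g (Z \<omega>)"
  using f
proof (induction rule: borel_measurable_induct)
  case (cong f f')
  then obtain h where "h \<in> borel_measurable L" "\<forall>\<omega>\<in>space M. f' \<omega> = h (Z \<omega>)" by blast
  then show ?case using cong(3) by (intro bexI[of _ h]) auto
next
  case (set A)
  then obtain C where "C \<in> sets L" "A = Z -` C \<inter> space M" unfolding sets_generated[OF Z] by blast
  then show ?case by (intro bexI[of _ "indicator C"]) (auto simp: indicator_def)
next
  case (mult u c)
  then obtain g where "g \<in> borel_measurable L" "\<forall>\<omega>\<in>space M. u \<omega> = g (Z \<omega>)" by blast
  then show ?case by (intro bexI[of _ "\<lambda>z. c * g z"]) auto
next
  case (add u v)
  then obtain g h where "g \<in> borel_measurable L" "\<forall>\<omega>\<in>space M. u \<omega> = g (Z \<omega>)"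
    "h \<in> borel_measurable L" "\<forall>\<omega>\<in>space M. v \<omega> = h (Z \<omega>)" by blast
  then show ?case by (intro bexI[of _ "\<lambda>z. h z + g z"]) auto
next
  case (seq U)
  then have "\<forall>i. \<exists>g. g \<in> borel_measurable L \<and> (\<forall>\<omega>\<in>space M. U i \<omega> = g (Z \<omega>))" by blast
  then obtain g where g: "\<And>i. g i \<in> borel_measurable L" "\<And>i \<omega>. \<omega> \<in> space M \<Longrightarrow> U i \<omega> = g i (Z \<omega>)"
    by (metis (no_types))
  have "(\<lambda>z. SUP i. g i z) \<in> borel_measurable L" using g(1) by (intro borel_measurable_SUP) auto
  then show ?case using g(2) by (intro bexI[of _ "\<lambda>z. SUP i. g i z"]) (auto simp: image_comp)
qed

lemma (in prob_space) finite_measure_subalgebra_generated: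
  "Z \<in> M \<rightarrow>\<^sub>M L \<Longrightarrow> finite_measure_subalgebra M (generated M Z L)"
  unfolding finite_measure_subalgebra_def finite_measure_subalgebra_axioms_def
  using subalgebra_generated finite_measure_axioms by auto

lemma kernel_prob_space:
  assumes "\<kappa> \<in> L \<rightarrow>\<^sub>M prob_algebra N" "z \<in> space L"
  shows "prob_space (\<kappa> z)" "sets (\<kappa> z) = sets N" "space (\<kappa> z) = space N"
  using measurable_space[OF assms] sets_eq_imp_space_eq[of "\<kappa> z" N] by (auto simp: space_prob_algebra)

lemma kernel_emeasure_measurable:
  assumes "\<kappa> \<in> L \<rightarrow>\<^sub>M prob_algebra N" "A \<in> sets N"
  shows "(\<lambda>z. emeasure (\<kappa> z) A) \<in> borel_measurable L" "(\<lambda>z. measure (\<kappa> z) A) \<in> borel_measurable L"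
  using measurable_compose[OF measurable_prob_algebraD[OF assms(1)] measurable_emeasure_subprob_algebra[OF assms(2)]]
    measurable_compose[OF measurable_prob_algebraD[OF assms(1)] measurable_measure_subprob_algebra[OF assms(2)]]
  by auto

text \<open>Conditional expectations are determined by integrals over the generated events, which
  are preimages under \<open>Z\<close>. The resulting identity on rectangles contains no conditional
  expectation and depends only on the joint law of \<open>Y\<close> and \<open>Z\<close>.\<close>

lemma (in prob_space) cond_dist_iff:
  assumes Y[measurable]: "Y \<in> M \<rightarrow>\<^sub>M N" and Z[measurable]: "Z \<in> M \<rightarrow>\<^sub>M L"
  shows "cond_dist M Y N Z L \<kappa> \<longleftrightarrow> \<kappa> \<in> L \<rightarrow>\<^sub>M prob_algebra N \<and>
    (\<forall>A\<in>sets N. \<forall>C\<in>sets L. emeasure M {\<omega> \<in> space M. Y \<omega> \<in> A \<and> Z \<omega> \<in> C} =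
       (\<integral>\<^sup>+\<omega>. emeasure (\<kappa> (Z \<omega>)) A * indicator C (Z \<omega>) \<partial>M))"
proof (cases "\<kappa> \<in> L \<rightarrow>\<^sub>M prob_algebra N")
  case \<kappa>[measurable]: True
  interpret G: finite_measure_subalgebra M "generated M Z L"
    by (rule finite_measure_subalgebra_generated[OF Z])
  have *: "(AE \<omega> in M. real_cond_exp M (generated M Z L) (indicator (Y -` A \<inter> space M)) \<omega> = measure (\<kappa> (Z \<omega>)) A)
      \<longleftrightarrow> (\<forall>C\<in>sets L. emeasure M {\<omega> \<in> space M. Y \<omega> \<in> A \<and> Z \<omega> \<in> C} =
       (\<integral>\<^sup>+\<omega>. emeasure (\<kappa> (Z \<omega>)) A * indicator C (Z \<omega>) \<partial>M))" (is "?L \<longleftrightarrow> ?R")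
    if [measurable]: "A \<in> sets N" for A
  proof -
    let ?Y = "Y -` A \<inter> space M"
    have p: "prob_space (\<kappa> (Z \<omega>))" if "\<omega> \<in> space M" for \<omega>
      using kernel_prob_space[OF \<kappa>] measurable_space[OF Z that] by auto
    note [measurable] = kernel_emeasure_measurable[OF \<kappa> \<open>A \<in> sets N\<close>]
    have le1: "measure (\<kappa> (Z \<omega>)) A \<le> 1" if "\<omega> \<in> space M" for \<omega>
      using p[OF that] by (rule prob_space.prob_le_1)
    have int: "integrable M (\<lambda>\<omega>. measure (\<kappa> (Z \<omega>)) A)"
      using le1 by (intro integrable_const_bound[where B = 1] AE_I2) auto
    have intY: "integrable M (indicator ?Y :: _ \<Rightarrow> real)" by (simp add: emeasure_eq_measure)
    have lhs: "emeasure M {\<omega> \<in> space M. Y \<omega> \<in> A \<and> Z \<omega> \<in> C} =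
        ennreal (LINT \<omega>:Z -` C \<inter> space M|M. indicator ?Y \<omega>)" if [measurable]: "C \<in> sets L" for C
    proof -
      have "(LINT \<omega>:Z -` C \<inter> space M|M. indicator ?Y \<omega> :: real) =
          (LINT \<omega>|M. indicator {\<omega> \<in> space M. Y \<omega> \<in> A \<and> Z \<omega> \<in> C} \<omega>)"
        unfolding set_lebesgue_integral_def
        by (intro Bochner_Integration.integral_cong) (auto simp: indicator_def)
      then show ?thesis by (simp add: emeasure_eq_measure)
    qed
    have rhs: "(\<integral>\<^sup>+\<omega>. emeasure (\<kappa> (Z \<omega>)) A * indicator C (Z \<omega>) \<partial>M) =
        ennreal (LINT \<omega>:Z -` C \<inter> space M|M. measure (\<kappa> (Z \<omega>)) A)" if [measurable]: "C \<in> sets L" for C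
    proof -
      have "(\<integral>\<^sup>+\<omega>. emeasure (\<kappa> (Z \<omega>)) A * indicator C (Z \<omega>) \<partial>M) =
          (\<integral>\<^sup>+\<omega>. ennreal (indicator (Z -` C \<inter> space M) \<omega> *\<^sub>R measure (\<kappa> (Z \<omega>)) A) \<partial>M)"
        using p by (intro nn_integral_cong)
          (auto simp: indicator_def finite_measure.emeasure_eq_measure prob_space.finite_measure)
      also have "\<dots> = ennreal (LINT \<omega>:Z -` C \<inter> space M|M. measure (\<kappa> (Z \<omega>)) A)"
        unfolding set_lebesgue_integral_def
        by (intro nn_integral_eq_integral integrable_mult_indicator int) auto
      finally show ?thesis .
    qed
    have nonneg: "0 \<le> (LINT \<omega>:D|M. f \<omega>)" if "\<And>\<omega>. 0 \<le> f \<omega>" for f :: "'a \<Rightarrow> real" and D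
      unfolding set_lebesgue_integral_def using that by (auto intro!: integral_nonneg_AE)
    have R: "?R \<longleftrightarrow> (\<forall>D\<in>sets (generated M Z L).
        (LINT \<omega>:D|M. indicator ?Y \<omega>) = (LINT \<omega>:D|M. measure (\<kappa> (Z \<omega>)) A))"
      unfolding sets_generated[OF Z] by (auto simp: lhs rhs nonneg)
    show ?thesis
      unfolding R
    proof
      assume L: ?L
      show "\<forall>D\<in>sets (generated M Z L). (LINT \<omega>:D|M. indicator ?Y \<omega>) = (LINT \<omega>:D|M. measure (\<kappa> (Z \<omega>)) A)"
      proof
        fix D assume D: "D \<in> sets (generated M Z L)"
        then have [measurable]: "D \<in> sets M" by (auto simp: sets_generated[OF Z])
        have "(LINT \<omega>:D|M. indicator ?Y \<omega>) = (LINT \<omega>:D|M. real_cond_exp M (generated M Z L) (indicator ?Y) \<omega>)"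
          by (rule G.real_cond_exp_intA[OF intY D])
        also have "\<dots> = (LINT \<omega>:D|M. measure (\<kappa> (Z \<omega>)) A)"
          unfolding set_lebesgue_integral_def using L by (intro integral_cong_AE) auto
        finally show "(LINT \<omega>:D|M. indicator ?Y \<omega>) = (LINT \<omega>:D|M. measure (\<kappa> (Z \<omega>)) A)" .
      qed
    next
      assume "\<forall>D\<in>sets (generated M Z L). (LINT \<omega>:D|M. indicator ?Y \<omega>) = (LINT \<omega>:D|M. measure (\<kappa> (Z \<omega>)) A)"
      then show ?L
        by (intro G.real_cond_exp_charact intY int
            measurable_compose[OF measurable_generated[OF Z]]) auto
    qed
  qed
  show ?thesis unfolding cond_dist_def using * \<kappa> by auto
qed (simp add: cond_dist_def)

text \<open>Restricted to the event \<open>Y \<in> A\<close>, the law of \<open>Z\<close> has the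
  density \<open>\<lambda>z. emeasure (\<kappa> z) A\<close> with respect to the full law of
  \<open>Z\<close>; integrate \<open>g\<close> against both descriptions.\<close>

lemma (in prob_space) cond_dist_nn_integral:
  assumes cd: "cond_dist M Y N Z L \<kappa>"
    and Y[measurable]: "Y \<in> M \<rightarrow>\<^sub>M N" and Z[measurable]: "Z \<in> M \<rightarrow>\<^sub>M L"
    and A[measurable]: "A \<in> sets N" and g[measurable]: "g \<in> borel_measurable L"
  shows "(\<integral>\<^sup>+\<omega>. g (Z \<omega>) * indicator A (Y \<omega>) \<partial>M) = (\<integral>\<^sup>+\<omega>. g (Z \<omega>) * emeasure (\<kappa> (Z \<omega>)) A \<partial>M)"
proof -
  have \<kappa>: "\<kappa> \<in> L \<rightarrow>\<^sub>M prob_algebra N" using cd by (simp add: cond_dist_def)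
  note [measurable] = kernel_emeasure_measurable[OF \<kappa> A]
  have "distr (density M (\<lambda>\<omega>. indicator A (Y \<omega>))) L Z = density (distr M L Z) (\<lambda>z. emeasure (\<kappa> z) A)"
  proof (rule measure_eqI)
    fix C assume "C \<in> sets (distr (density M (\<lambda>\<omega>. indicator A (Y \<omega>))) L Z)"
    then have [measurable]: "C \<in> sets L" by simp
    have "emeasure (distr (density M (\<lambda>\<omega>. indicator A (Y \<omega>))) L Z) C =
        (\<integral>\<^sup>+\<omega>. indicator {\<omega> \<in> space M. Y \<omega> \<in> A \<and> Z \<omega> \<in> C} \<omega> \<partial>M)"
      by (subst emeasure_distr, simp, simp, subst emeasure_density, simp, simp, rule nn_integral_cong)
        (auto simp: indicator_def)
    also have "\<dots> = (\<integral>\<^sup>+\<omega>. emeasure (\<kappa> (Z \<omega>)) A * indicator C (Z \<omega>) \<partial>M)"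
      using cd unfolding cond_dist_iff[OF Y Z] by simp
    also have "\<dots> = emeasure (density (distr M L Z) (\<lambda>z. emeasure (\<kappa> z) A)) C"
      by (subst emeasure_density) (simp_all add: nn_integral_distr)
    finally show "emeasure (distr (density M (\<lambda>\<omega>. indicator A (Y \<omega>))) L Z) C =
        emeasure (density (distr M L Z) (\<lambda>z. emeasure (\<kappa> z) A)) C" .
  qed simp
  then have "(\<integral>\<^sup>+z. g z \<partial>distr (density M (\<lambda>\<omega>. indicator A (Y \<omega>))) L Z) =
      (\<integral>\<^sup>+z. g z \<partial>density (distr M L Z) (\<lambda>z. emeasure (\<kappa> z) A))" by simp
  then show ?thesis
    by (simp add: nn_integral_distr nn_integral_density mult.commute)
qed

text \<open>The joint law is the mixture of the kernel over \<open>M\<close>, since both measures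
  agree on rectangles. Events such as \<open>Y\<close> being equal to a function of \<open>Z\<close>
  are no rectangles and need this form.\<close>

lemma (in prob_space) cond_dist_joint:
  assumes cd: "cond_dist M Y N Z L \<kappa>"
    and Y[measurable]: "Y \<in> M \<rightarrow>\<^sub>M N" and Z[measurable]: "Z \<in> M \<rightarrow>\<^sub>M L"
    and B[measurable]: "B \<in> sets (L \<Otimes>\<^sub>M N)"
  shows "emeasure M {\<omega> \<in> space M. (Z \<omega>, Y \<omega>) \<in> B} = (\<integral>\<^sup>+\<omega>. emeasure (\<kappa> (Z \<omega>)) (Pair (Z \<omega>) -` B) \<partial>M)"
proof -
  have \<kappa>: "\<kappa> \<in> L \<rightarrow>\<^sub>M prob_algebra N" using cd by (simp add: cond_dist_def)
  have \<kappa>'[measurable]: "\<kappa> \<in> L \<rightarrow>\<^sub>M subprob_algebra N" by (rule measurable_prob_algebraD[OF \<kappa>])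
  let ?K = "\<lambda>\<omega>. distr (\<kappa> (Z \<omega>)) (L \<Otimes>\<^sub>M N) (Pair (Z \<omega>))"
  have K: "?K \<in> M \<rightarrow>\<^sub>M subprob_algebra (L \<Otimes>\<^sub>M N)"
    by (rule measurable_distr2[where M = N and f = "\<lambda>\<omega> y. (Z \<omega>, y)" and g = "\<lambda>\<omega>. \<kappa> (Z \<omega>)"]) measurable
  have eK: "emeasure (?K \<omega>) D = emeasure (\<kappa> (Z \<omega>)) (Pair (Z \<omega>) -` D)"
    if "\<omega> \<in> space M" "D \<in> sets (L \<Otimes>\<^sub>M N)" for \<omega> D
  proof -
    have z: "Z \<omega> \<in> space L" using measurable_space[OF Z that(1)] .
    have "Pair (Z \<omega>) \<in> \<kappa> (Z \<omega>) \<rightarrow>\<^sub>M L \<Otimes>\<^sub>M N"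
      unfolding measurable_cong_sets[OF kernel_prob_space(2)[OF \<kappa> z] refl] by (rule measurable_Pair1'[OF z])
    moreover have "Pair (Z \<omega>) -` D \<inter> space (\<kappa> (Z \<omega>)) = Pair (Z \<omega>) -` D"
      using sets.sets_into_space[OF that(2)] kernel_prob_space(3)[OF \<kappa> z] by (auto simp: space_pair_measure)
    ultimately show ?thesis using that by (simp add: emeasure_distr)
  qed
  have "distr M (L \<Otimes>\<^sub>M N) (\<lambda>\<omega>. (Z \<omega>, Y \<omega>)) = M \<bind> ?K"
  proof (rule measure_eqI_generator_eq[OF Int_stable_pair_measure_generator[of L N]])
    let ?E = "{a \<times> b | a b. a \<in> sets L \<and> b \<in> sets N}"
    show "?E \<subseteq> Pow (space L \<times> space N)"
      using sets.space_closed[of L] sets.space_closed[of N] by auto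
    show "sets (distr M (L \<Otimes>\<^sub>M N) (\<lambda>\<omega>. (Z \<omega>, Y \<omega>))) = sigma_sets (space L \<times> space N) ?E"
      by (simp add: sets_pair_measure)
    show "sets (M \<bind> ?K) = sigma_sets (space L \<times> space N) ?E"
      using sets_bind_measurable[OF K not_empty] by (simp add: sets_pair_measure)
    show "range (\<lambda>i::nat. space L \<times> space N) \<subseteq> ?E" by auto
    show "(\<Union>i::nat. space L \<times> space N) = space L \<times> space N" by simp
    show "emeasure (distr M (L \<Otimes>\<^sub>M N) (\<lambda>\<omega>. (Z \<omega>, Y \<omega>))) (space L \<times> space N) \<noteq> \<infinity>" for i :: nat
      by (subst emeasure_distr) (auto simp: emeasure_eq_measure)
    fix D assume "D \<in> ?E"
    then obtain C A where D: "D = C \<times> A" and [measurable]: "C \<in> sets L" "A \<in> sets N" by auto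
    have "emeasure (distr M (L \<Otimes>\<^sub>M N) (\<lambda>\<omega>. (Z \<omega>, Y \<omega>))) D = emeasure M {\<omega> \<in> space M. Y \<omega> \<in> A \<and> Z \<omega> \<in> C}"
      unfolding D by (subst emeasure_distr, simp, simp, rule arg_cong[where f = "emeasure M"]) auto
    also have "\<dots> = (\<integral>\<^sup>+\<omega>. emeasure (\<kappa> (Z \<omega>)) A * indicator C (Z \<omega>) \<partial>M)"
      using cd unfolding cond_dist_iff[OF Y Z] by simp
    also have "\<dots> = (\<integral>\<^sup>+\<omega>. emeasure (?K \<omega>) D \<partial>M)"
      by (rule nn_integral_cong) (subst eK, auto simp: D indicator_def)
    also have "\<dots> = emeasure (M \<bind> ?K) D"
      unfolding D by (rule emeasure_bind[OF not_empty K, symmetric]) simp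
    finally show "emeasure (distr M (L \<Otimes>\<^sub>M N) (\<lambda>\<omega>. (Z \<omega>, Y \<omega>))) D = emeasure (M \<bind> ?K) D" .
  qed
  then have "emeasure (distr M (L \<Otimes>\<^sub>M N) (\<lambda>\<omega>. (Z \<omega>, Y \<omega>))) B = (\<integral>\<^sup>+\<omega>. emeasure (?K \<omega>) B \<partial>M)"
    by (simp only: emeasure_bind[OF not_empty K B])
  also have "\<dots> = (\<integral>\<^sup>+\<omega>. emeasure (\<kappa> (Z \<omega>)) (Pair (Z \<omega>) -` B) \<partial>M)"
    by (intro nn_integral_cong) (simp add: eK)
  finally show ?thesis
    by (simp add: emeasure_distr vimage_def Int_def conj_commute[of "_ \<in> space M"])
qed

lemma cond_dist_compose:
  assumes cd: "cond_dist M Y N Z L \<kappa>" and Y: "Y \<in> M \<rightarrow>\<^sub>M N" and Z: "Z \<in> M \<rightarrow>\<^sub>M L" and f: "f \<in> N \<rightarrow>\<^sub>M N'"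
  shows "cond_dist M (\<lambda>\<omega>. f (Y \<omega>)) N' Z L (\<lambda>z. distr (\<kappa> z) N' f)"
  unfolding cond_dist_def
proof (intro conjI ballI)
  have \<kappa>: "\<kappa> \<in> L \<rightarrow>\<^sub>M prob_algebra N" using cd by (simp add: cond_dist_def)
  then show "(\<lambda>z. distr (\<kappa> z) N' f) \<in> L \<rightarrow>\<^sub>M prob_algebra N'"
    by (rule measurable_compose[OF _ measurable_distr_prob_space[OF f]])
  fix A assume A: "A \<in> sets N'"
  let ?B = "f -` A \<inter> space N"
  have "(\<lambda>\<omega>. f (Y \<omega>)) -` A \<inter> space M = Y -` ?B \<inter> space M"
    using measurable_space[OF Y] by auto
  moreover have "AE \<omega> in M. real_cond_exp M (generated M Z L) (indicator (Y -` ?B \<inter> space M)) \<omega> = measure (\<kappa> (Z \<omega>)) ?B"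
    using cd measurable_sets[OF f A] unfolding cond_dist_def by blast
  moreover have "measure (\<kappa> (Z \<omega>)) ?B = measure (distr (\<kappa> (Z \<omega>)) N' f) A" if "\<omega> \<in> space M" for \<omega>
  proof -
    note k = kernel_prob_space(2,3)[OF \<kappa> measurable_space[OF Z that]]
    have "f \<in> \<kappa> (Z \<omega>) \<rightarrow>\<^sub>M N'" using f measurable_cong_sets[OF k(1) refl] by blast
    then show ?thesis using A by (simp add: measure_distr k)
  qed
  ultimately show "AE \<omega> in M. real_cond_exp M (generated M Z L) (indicator ((\<lambda>\<omega>. f (Y \<omega>)) -` A \<inter> space M)) \<omega> =
      measure (distr (\<kappa> (Z \<omega>)) N' f) A"
    by auto
qed

text \<open>Splitting \<open>C\<close> along \<open>D\<close> leaves the identity for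
  \<open>\<kappa>'\<close> on one piece and the assumption \<open>off\<close> on the other. This is
  how an exceptional set that may have positive probability under the intervention is
  accommodated.\<close>

lemma (in prob_space) cond_dist_glue:
  assumes cd: "cond_dist M Y N Z L \<kappa>'" and \<kappa>: "\<kappa> \<in> L \<rightarrow>\<^sub>M prob_algebra N"
    and Y[measurable]: "Y \<in> M \<rightarrow>\<^sub>M N" and Z[measurable]: "Z \<in> M \<rightarrow>\<^sub>M L" and D[measurable]: "D \<in> sets L"
    and off: "\<And>A C. A \<in> sets N \<Longrightarrow> C \<in> sets L \<Longrightarrow> C \<inter> D = {} \<Longrightarrow>
      emeasure M {\<omega> \<in> space M. Y \<omega> \<in> A \<and> Z \<omega> \<in> C} = (\<integral>\<^sup>+\<omega>. emeasure (\<kappa> (Z \<omega>)) A * indicator C (Z \<omega>) \<partial>M)"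
  shows "cond_dist M Y N Z L (\<lambda>z. if z \<in> D then \<kappa>' z else \<kappa> z)" (is "cond_dist M Y N Z L ?\<kappa>")
  unfolding cond_dist_iff[OF Y Z]
proof (intro conjI ballI)
  have \<kappa>': "\<kappa>' \<in> L \<rightarrow>\<^sub>M prob_algebra N" using cd by (simp add: cond_dist_def)
  then show "?\<kappa> \<in> L \<rightarrow>\<^sub>M prob_algebra N" using \<kappa> D by (intro measurable_If_set) auto
  fix A C assume A[measurable]: "A \<in> sets N" and C[measurable]: "C \<in> sets L"
  note [measurable] = kernel_emeasure_measurable[OF \<kappa> A] kernel_emeasure_measurable[OF \<kappa>' A]
  let ?E = "\<lambda>C. {\<omega> \<in> space M. Y \<omega> \<in> A \<and> Z \<omega> \<in> C}"
  have "emeasure M (?E C) = emeasure M (?E (C \<inter> D)) + emeasure M (?E (C - D))"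
    by (subst plus_emeasure) (auto intro!: arg_cong[where f = "emeasure M"])
  also have "emeasure M (?E (C \<inter> D)) = (\<integral>\<^sup>+\<omega>. emeasure (\<kappa>' (Z \<omega>)) A * indicator (C \<inter> D) (Z \<omega>) \<partial>M)"
    using cd A C D unfolding cond_dist_iff[OF Y Z] by blast
  also have "emeasure M (?E (C - D)) = (\<integral>\<^sup>+\<omega>. emeasure (\<kappa> (Z \<omega>)) A * indicator (C - D) (Z \<omega>) \<partial>M)"
    by (rule off) auto
  also have "(\<integral>\<^sup>+\<omega>. emeasure (\<kappa>' (Z \<omega>)) A * indicator (C \<inter> D) (Z \<omega>) \<partial>M) +
      (\<integral>\<^sup>+\<omega>. emeasure (\<kappa> (Z \<omega>)) A * indicator (C - D) (Z \<omega>) \<partial>M) =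
      (\<integral>\<^sup>+\<omega>. emeasure (\<kappa>' (Z \<omega>)) A * indicator (C \<inter> D) (Z \<omega>) + emeasure (\<kappa> (Z \<omega>)) A * indicator (C - D) (Z \<omega>) \<partial>M)"
    by (rule nn_integral_add[symmetric]) measurable
  also have "\<dots> = (\<integral>\<^sup>+\<omega>. emeasure (?\<kappa> (Z \<omega>)) A * indicator C (Z \<omega>) \<partial>M)"
    by (rule nn_integral_cong) (auto simp: indicator_def)
  finally show "emeasure M (?E C) = (\<integral>\<^sup>+\<omega>. emeasure (?\<kappa> (Z \<omega>)) A * indicator C (Z \<omega>) \<partial>M)" .
qed

lemma cond_dist_cong_AE:
  assumes cd: "cond_dist M Y N Z L \<kappa>" and \<kappa>': "\<kappa>' \<in> L \<rightarrow>\<^sub>M prob_algebra N"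
    and eq: "AE \<omega> in M. \<kappa>' (Z \<omega>) = \<kappa> (Z \<omega>)"
  shows "cond_dist M Y N Z L \<kappa>'"
  unfolding cond_dist_def
proof (intro conjI ballI \<kappa>')
  fix A assume "A \<in> sets N"
  then have "AE \<omega> in M. real_cond_exp M (generated M Z L) (indicator (Y -` A \<inter> space M)) \<omega> = measure (\<kappa> (Z \<omega>)) A"
    using cd by (simp add: cond_dist_def)
  then show "AE \<omega> in M. real_cond_exp M (generated M Z L) (indicator (Y -` A \<inter> space M)) \<omega> = measure (\<kappa>' (Z \<omega>)) A"
    using eq by eventually_elim simp
qed

section \<open>Existence of regular conditional distributions\<close>

lemma Inf_rational_above_mono:
  fixes p :: "real \<Rightarrow> real"
  assumes "\<And>q. 0 \<le> p q" "x \<le> y"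
  shows "(INF q\<in>{q\<in>\<rat>. x < q}. p q) \<le> (INF q\<in>{q\<in>\<rat>. y < q}. p q)"
proof (rule cINF_superset_mono)
  show "{q\<in>\<rat>. y < q} \<noteq> {}" using Rats_dense_in_real[of y "y + 1"] by auto
  show "bdd_below (p ` {q\<in>\<rat>. x < q})" using assms(1) by (auto intro: bdd_belowI[where m = 0])
qed (use assms in auto)

text \<open>A rational \<open>q\<close> strictly above \<open>x\<close> stays strictly above all
  nearby points on the right, so a value \<open>p q\<close> that nearly attains the infimum at
  \<open>x\<close> also bounds the infimum at these points.\<close>

lemma continuous_at_right_Inf_rational_above:
  fixes p :: "real \<Rightarrow> real"
  assumes nonneg: "\<And>q. 0 \<le> p q"
  shows "continuous (at_right x) (\<lambda>x. INF q\<in>{q\<in>\<rat>. x < q}. p q)" (is "continuous _ ?F")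
  unfolding continuous_within
proof (rule order_tendstoI)
  fix l assume "l < ?F x"
  then have "l < ?F y" if "x < y" for y
    using Inf_rational_above_mono[of p x y] nonneg that by auto
  then show "\<forall>\<^sub>F y in at_right x. l < ?F y" by (auto simp: eventually_at_right_field gt_ex)
next
  fix u assume "?F x < u"
  moreover have "{q\<in>\<rat>. x < q} \<noteq> {}" using Rats_dense_in_real[of x "x + 1"] by auto
  moreover have bdd: "bdd_below (p ` {q\<in>\<rat>. y < q})" for y using nonneg by (auto intro: bdd_belowI[where m = 0])
  ultimately obtain q where q: "q \<in> \<rat>" "x < q" "p q < u" by (auto simp: cINF_less_iff)
  have "?F y < u" if "y < q" for y
    using cINF_lower[OF bdd, of q y] q that by auto
  then show "\<forall>\<^sub>F y in at_right x. ?F y < u"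
    using q by (auto simp: eventually_at_right_field)
qed

lemma Int_stable_atMost: "Int_stable (range (atMost :: real \<Rightarrow> _))"
proof (rule Int_stableI, clarify)
  fix x y :: real
  have "{..x} \<inter> {..y} = {..min x y}" by auto
  then show "{..x} \<inter> {..y} \<in> range atMost" by blast
qed

text \<open>The conditional probability, read as a non-negative extended real, factors through
  \<open>Z\<close>. Its bounds hold almost surely only; clipping the factor at \<open>1\<close>
  makes them hold at every \<open>z\<close> and changes nothing almost surely.\<close>

lemma (in prob_space) cond_prob_factor:
  assumes Z[measurable]: "Z \<in> M \<rightarrow>\<^sub>M L" and E[measurable]: "E \<in> sets M"
  obtains p where "p \<in> borel_measurable L" "\<And>z. 0 \<le> p z" "\<And>z. p z \<le> (1::real)"
    "AE \<omega> in M. real_cond_exp M (generated M Z L) (indicator E) \<omega> = p (Z \<omega>)"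
proof -
  interpret G: finite_measure_subalgebra M "generated M Z L"
    by (rule finite_measure_subalgebra_generated[OF Z])
  let ?f = "real_cond_exp M (generated M Z L) (indicator E)"
  have "(\<lambda>\<omega>. ennreal (?f \<omega>)) \<in> borel_measurable (generated M Z L)"
    by (intro measurable_compose[OF borel_measurable_cond_exp measurable_ennreal])
  then obtain g where g[measurable]: "g \<in> borel_measurable L" and eq: "\<And>\<omega>. \<omega> \<in> space M \<Longrightarrow> ennreal (?f \<omega>) = g (Z \<omega>)"
    using borel_measurable_generated_factor[OF Z] by blast
  have int: "integrable M (indicator E :: _ \<Rightarrow> real)" by (simp add: emeasure_eq_measure)
  have "AE \<omega> in M. ?f \<omega> \<ge> 0" "AE \<omega> in M. ?f \<omega> \<le> 1"
    using int by (intro G.real_cond_exp_ge_c G.real_cond_exp_le_c; simp add: indicator_def)+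
  then have "AE \<omega> in M. ?f \<omega> = min 1 (enn2real (g (Z \<omega>)))"
    using AE_space by eventually_elim (simp add: eq[symmetric])
  then show ?thesis by (intro that[of "\<lambda>z. min 1 (enn2real (g z))"]) auto
qed

text \<open>
  The values of \<open>Y\<close> lie in \<open>{-2..2}\<close>, so the version of \<open>P(Y \<le> q | Z)\<close> can be chosen to be \<open>0\<close> for
  \<open>q < -2\<close> and \<open>1\<close> for \<open>q > 2\<close>; then the right-continuous modification is a distribution function for
  every value of \<open>Z\<close>.
\<close>

lemma (in prob_space) cond_dist_exists_bounded:
  fixes Y :: "'a \<Rightarrow> real"
  assumes Y[measurable]: "Y \<in> borel_measurable M" and Z[measurable]: "Z \<in> M \<rightarrow>\<^sub>M L"
    and bounded: "\<And>\<omega>. \<omega> \<in> space M \<Longrightarrow> \<bar>Y \<omega>\<bar> \<le> 2"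
  obtains \<kappa> where "cond_dist M Y borel Z L \<kappa>"
proof -
  interpret G: finite_measure_subalgebra M "generated M Z L"
    by (rule finite_measure_subalgebra_generated[OF Z])
  define c where "c x = real_cond_exp M (generated M Z L) (indicator (Y -` {..x} \<inter> space M))" for x
  have E[measurable]: "Y -` {..x} \<inter> space M \<in> sets M" for x by measurable
  have int: "integrable M (indicator (Y -` {..x} \<inter> space M) :: _ \<Rightarrow> real)" for x
    by (simp add: emeasure_eq_measure)
  have ex: "\<forall>x. \<exists>p. p \<in> borel_measurable L \<and> (\<forall>z. 0 \<le> p z \<and> p z \<le> (1::real)) \<and> (AE \<omega> in M. c x \<omega> = p (Z \<omega>)) \<and>
      (x < -2 \<longrightarrow> (\<forall>z. p z = 0)) \<and> (x > 2 \<longrightarrow> (\<forall>z. p z = 1))"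
  proof
    fix x
    obtain p where p: "p \<in> borel_measurable L" "\<And>z. 0 \<le> p z" "\<And>z. p z \<le> (1::real)"
        "AE \<omega> in M. c x \<omega> = p (Z \<omega>)"
      unfolding c_def using cond_prob_factor[OF Z E[of x]] by blast
    consider "x < -2" | "x > 2" | "-2 \<le> x" "x \<le> 2" by linarith
    then show "\<exists>p. p \<in> borel_measurable L \<and> (\<forall>z. 0 \<le> p z \<and> p z \<le> (1::real)) \<and> (AE \<omega> in M. c x \<omega> = p (Z \<omega>)) \<and>
      (x < -2 \<longrightarrow> (\<forall>z. p z = 0)) \<and> (x > 2 \<longrightarrow> (\<forall>z. p z = 1))"
    proof cases
      case 1
      then have "Y -` {..x} \<inter> space M = {}" using bounded by fastforce
      then have "AE \<omega> in M. c x \<omega> = 0"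
        using G.real_cond_exp_F_meas[of "\<lambda>_. 0"] by (simp add: c_def indicator_def[abs_def])
      then show ?thesis using 1 by (intro exI[of _ "\<lambda>_. 0"]) auto
    next
      case 2
      then have *: "Y -` {..x} \<inter> space M = space M" using bounded by fastforce
      have "AE \<omega> in M. c x \<omega> = indicator (space M) \<omega>"
        unfolding c_def * using int[of x]
        by (intro G.real_cond_exp_F_meas) (auto simp: * intro!: borel_measurable_indicator sets.top[of "generated M Z L", simplified])
      then have "AE \<omega> in M. c x \<omega> = 1" by (rule AE_mp) (auto intro!: AE_I2)
      then show ?thesis using 2 by (intro exI[of _ "\<lambda>_. 1"]) auto
    next
      case 3
      then show ?thesis using p by (intro exI[of _ p]) auto
    qed
  qed
  from choice[OF ex] obtain p where *: "\<And>x. p x \<in> borel_measurable L \<and>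
      (\<forall>z. 0 \<le> p x z \<and> p x z \<le> (1::real)) \<and> (AE \<omega> in M. c x \<omega> = p x (Z \<omega>)) \<and>
      (x < -2 \<longrightarrow> (\<forall>z. p x z = 0)) \<and> (x > 2 \<longrightarrow> (\<forall>z. p x z = 1))" by blast
  have p_meas: "\<And>x. p x \<in> borel_measurable L"
    and p: "\<And>x z. 0 \<le> p x z" "\<And>x z. p x z \<le> 1"
    and c: "\<And>x. AE \<omega> in M. c x \<omega> = p x (Z \<omega>)"
    and out: "\<And>x z. x < -2 \<Longrightarrow> p x z = 0" "\<And>x z. x > 2 \<Longrightarrow> p x z = 1"
    using * by auto
  \<comment> \<open>Rational levels suffice and are countable, so the null sets of the chosen
    versions can be combined and the infima are measurable.\<close>
  define Q where "Q x = {q\<in>\<rat>. x < q}" for x :: real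
  have Q: "countable (Q x)" "Q x \<noteq> {}" for x
    using Rats_dense_in_real[of x "x + 1"] countable_subset[OF _ countable_rat, of "{q\<in>\<rat>. x < q}"]
    by (auto simp: Q_def)
  define F where "F z x = (INF q\<in>Q x. p q z)" for z x
  have bdd: "bdd_below ((\<lambda>q. p q z) ` A)" for A z using p(1) by (auto intro!: bdd_belowI[where m = 0])
  have F_le: "F z x \<le> p q z" if "q \<in> Q x" for q x z
    unfolding F_def using that by (intro cINF_lower bdd)
  have F_ge: "u \<le> F z x" if "\<And>q. q \<in> Q x \<Longrightarrow> u \<le> p q z" for u x z
    unfolding F_def using that Q by (intro cINF_greatest) auto
  have F01: "0 \<le> F z x" "F z x \<le> 1" for z x
    using F_ge[of x 0 z] F_le[of _ x z] Q(2)[of x] p order_trans by (blast, blast)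
  have F_mono: "F z x \<le> F z y" if "x \<le> y" for z x y
    unfolding F_def Q_def using that p by (intro Inf_rational_above_mono)
  have F_cont: "continuous (at_right x) (F z)" for z x
    unfolding F_def[abs_def] Q_def using p by (intro continuous_at_right_Inf_rational_above)
  have F_bot: "(F z \<longlongrightarrow> 0) at_bot" for z
  proof (rule tendsto_eventually)
    have "F z x = 0" if "x < -2" for x
    proof -
      obtain q where "q \<in> \<rat>" "x < q" "q < -2" using Rats_dense_in_real[OF \<open>x < -2\<close>] by auto
      then show ?thesis using F_le[of q x z] F01[of z x] out by (auto simp: Q_def)
    qed
    then show "\<forall>\<^sub>F x in at_bot. F z x = 0" unfolding eventually_at_bot_dense by blast
  qed
  have F_top: "(F z \<longlongrightarrow> 1) at_top" for z
  proof (rule tendsto_eventually)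
    have "F z x = 1" if "x > 2" for x
      using F_ge[of x 1 z] F01[of z x] out that by (force simp: Q_def)
    then show "\<forall>\<^sub>F x in at_top. F z x = 1" unfolding eventually_at_top_dense by blast
  qed
  have F_meas[measurable]: "(\<lambda>z. F z x) \<in> borel_measurable L" for x
    unfolding F_def using Q p_meas bdd by (intro borel_measurable_cINF) auto
  define \<kappa> where "\<kappa> z = interval_measure (F z)" for z
  interpret \<kappa>: real_distribution "\<kappa> z" for z
    unfolding \<kappa>_def by (intro real_distribution_interval_measure F_mono F_cont F_bot F_top)
  have cdf: "emeasure (\<kappa> z) {..x} = ennreal (F z x)" for z x
    using cdf_interval_measure[OF F_mono F_cont F_bot, of z]
    by (simp add: cdf_def fun_eq_iff \<kappa>.emeasure_eq_measure \<kappa>_def[symmetric])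
  have \<kappa>_meas: "\<kappa> \<in> L \<rightarrow>\<^sub>M prob_algebra borel"
  proof (rule measurable_prob_algebra_generated[where \<Omega> = UNIV and G = "range atMost"])
    show "sets borel = sigma_sets UNIV (range (atMost :: real \<Rightarrow> _))"
      by (subst borel_eq_atMost) simp
    show "Int_stable (range (atMost :: real \<Rightarrow> _))" by (rule Int_stable_atMost)
  qed (auto simp: cdf intro: \<kappa>.prob_space_axioms)
  \<comment> \<open>Monotonicity in the level gives one inequality. The integrals agree because the
    unconditional distribution function of \<open>Y\<close> is continuous from the right, and a
    non-negative difference with integral zero vanishes almost surely.\<close>
  have F_c: "AE \<omega> in M. F (Z \<omega>) x = c x \<omega>" for x
  proof -
    have mono: "AE \<omega> in M. c x \<omega> \<le> c q \<omega>" if "q \<in> Q x" for q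
      unfolding c_def using int that
      by (intro G.real_cond_exp_mono) (auto simp: Q_def indicator_def)
    have "AE \<omega> in M. \<forall>q\<in>Q x. c x \<omega> \<le> p q (Z \<omega>)"
      unfolding AE_ball_countable[OF Q(1)]
    proof
      fix q assume "q \<in> Q x"
      from mono[OF this] c[of q] show "AE \<omega> in M. c x \<omega> \<le> p q (Z \<omega>)" by eventually_elim simp
    qed
    then have ge: "AE \<omega> in M. 0 \<le> F (Z \<omega>) x - c x \<omega>"
      by eventually_elim (auto intro: F_ge)
    have intF: "integrable M (\<lambda>\<omega>. F (Z \<omega>) x)"
      using F01 by (intro integrable_const_bound[where B = 1]) auto
    have intc: "integrable M (c y)" "integral\<^sup>L M (c y) = cdf (distr M borel Y) y" for y
    proof -
      show "integrable M (c y)" unfolding c_def by (rule G.real_cond_exp_int(1)[OF int])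
      have "integral\<^sup>L M (c y) = integral\<^sup>L M (indicator (Y -` {..y} \<inter> space M))"
        unfolding c_def by (rule G.real_cond_exp_int(2)[OF int])
      also have "\<dots> = cdf (distr M borel Y) y" by (simp add: cdf_def measure_distr)
      finally show "integral\<^sup>L M (c y) = cdf (distr M borel Y) y" .
    qed
    interpret D: real_distribution "distr M borel Y" by simp
    have "(\<integral>\<omega>. F (Z \<omega>) x \<partial>M) \<le> cdf (distr M borel Y) q" if "q \<in> Q x" for q
    proof -
      have "(\<integral>\<omega>. F (Z \<omega>) x \<partial>M) \<le> integral\<^sup>L M (c q)"
      proof (rule integral_mono_AE[OF intF intc(1)])
        show "AE \<omega> in M. F (Z \<omega>) x \<le> c q \<omega>"
          using c[of q] by eventually_elim (simp add: F_le[OF that])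
      qed
      then show ?thesis by (simp add: intc)
    qed
    moreover have "\<exists>q\<in>Q x. cdf (distr M borel Y) q < u" if u: "cdf (distr M borel Y) x < u" for u
    proof -
      have "\<forall>\<^sub>F y in at_right x. cdf (distr M borel Y) y < u"
        using D.cdf_is_right_cont[of x] u unfolding continuous_within by (rule order_tendstoD(2))
      then obtain b where b: "x < b" "\<And>y. x < y \<Longrightarrow> y < b \<Longrightarrow> cdf (distr M borel Y) y < u"
        by (auto simp: eventually_at_right_field)
      obtain q where "q \<in> \<rat>" "x < q" "q < b" using Rats_dense_in_real[OF b(1)] by auto
      then show ?thesis using b(2) by (auto simp: Q_def)
    qed
    ultimately have "\<not> cdf (distr M borel Y) x < (\<integral>\<omega>. F (Z \<omega>) x \<partial>M)"
      by (force simp: not_less[symmetric])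
    then have "(\<integral>\<omega>. F (Z \<omega>) x \<partial>M) \<le> cdf (distr M borel Y) x" by simp
    then have "(\<integral>\<omega>. F (Z \<omega>) x - c x \<omega> \<partial>M) \<le> 0"
      using intF intc by simp
    moreover have "0 \<le> (\<integral>\<omega>. F (Z \<omega>) x - c x \<omega> \<partial>M)"
      by (rule integral_nonneg_AE[OF ge])
    ultimately have "(\<integral>\<omega>. F (Z \<omega>) x - c x \<omega> \<partial>M) = 0" by simp
    then have "AE \<omega> in M. F (Z \<omega>) x - c x \<omega> = 0"
      using integral_nonneg_eq_0_iff_AE[OF Bochner_Integration.integrable_diff[OF intF intc(1)] ge] by blast
    then show ?thesis by eventually_elim simp
  qed
  have "cond_dist M Y borel Z L \<kappa>"
    unfolding cond_dist_iff[OF Y Z]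
  proof (intro conjI ballI \<kappa>_meas)
    fix A :: "real set" and C assume A: "A \<in> sets borel" and C[measurable]: "C \<in> sets L"
    have \<kappa>'[measurable]: "\<kappa> \<in> L \<rightarrow>\<^sub>M subprob_algebra borel" by (rule measurable_prob_algebraD[OF \<kappa>_meas])
    \<comment> \<open>Restricting \<open>M\<close> to \<open>Z \<in> C\<close> turns both sides into
      finite measures in \<open>A\<close>, so half-lines \<open>{..x}\<close> suffice to compare
      them.\<close>
    let ?M = "density M (\<lambda>\<omega>. indicator C (Z \<omega>))"
    have ne: "space ?M \<noteq> {}" by (simp add: not_empty)
    have K: "(\<lambda>\<omega>. \<kappa> (Z \<omega>)) \<in> ?M \<rightarrow>\<^sub>M subprob_algebra borel" by measurable
    have bind: "emeasure (?M \<bind> (\<lambda>\<omega>. \<kappa> (Z \<omega>))) B = (\<integral>\<^sup>+\<omega>. emeasure (\<kappa> (Z \<omega>)) B * indicator C (Z \<omega>) \<partial>M)"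
      if "B \<in> sets borel" for B
      using kernel_emeasure_measurable(1)[OF \<kappa>_meas that]
      by (simp add: emeasure_bind[OF ne K that] nn_integral_density mult.commute[of "indicator C _"])
    have distr: "emeasure (distr ?M borel Y) B = emeasure M {\<omega> \<in> space M. Y \<omega> \<in> B \<and> Z \<omega> \<in> C}"
      if [measurable]: "B \<in> sets borel" for B
    proof -
      have "emeasure (distr ?M borel Y) B = (\<integral>\<^sup>+\<omega>. indicator {\<omega> \<in> space M. Y \<omega> \<in> B \<and> Z \<omega> \<in> C} \<omega> \<partial>M)"
        by (subst emeasure_distr, simp, simp, subst emeasure_density, simp, simp, rule nn_integral_cong)
          (auto simp: indicator_def)
      then show ?thesis by simp
    qed
    have "distr ?M borel Y = ?M \<bind> (\<lambda>\<omega>. \<kappa> (Z \<omega>))"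
    proof (rule measure_eqI_generator_eq[where \<Omega> = UNIV and E = "range atMost" and A = "\<lambda>i. {..real i}"])
      have "sets borel = sigma_sets UNIV (range (atMost :: real \<Rightarrow> _))"
        by (subst borel_eq_atMost) simp
      then show "sets (distr ?M borel Y) = sigma_sets UNIV (range atMost)"
        "sets (?M \<bind> (\<lambda>\<omega>. \<kappa> (Z \<omega>))) = sigma_sets UNIV (range atMost)"
        by (simp_all only: sets_distr sets_bind_measurable[OF K ne])
      show "Int_stable (range (atMost :: real \<Rightarrow> _))" by (rule Int_stable_atMost)
      show "(\<Union>i. {..real i}) = UNIV" by (auto intro: real_arch_simple)
      show "emeasure (distr ?M borel Y) {..real i} \<noteq> \<infinity>" for i
        by (simp add: distr emeasure_eq_measure)
      fix B :: "real set" assume "B \<in> range atMost"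
      then obtain x where B: "B = {..x}" by auto
      have [measurable]: "{\<omega> \<in> space M. Y \<omega> \<le> x \<and> Z \<omega> \<in> C} \<in> sets M" by measurable
      have D: "Z -` C \<inter> space M \<in> sets (generated M Z L)" using C by (auto simp: sets_generated[OF Z])
      have "emeasure (distr ?M borel Y) B = ennreal (LINT \<omega>|M. indicator {\<omega> \<in> space M. Y \<omega> \<le> x \<and> Z \<omega> \<in> C} \<omega>)"
        by (simp add: B distr emeasure_eq_measure)
      also have "(LINT \<omega>|M. indicator {\<omega> \<in> space M. Y \<omega> \<le> x \<and> Z \<omega> \<in> C} \<omega> :: real) =
          (LINT \<omega>:Z -` C \<inter> space M|M. indicator (Y -` {..x} \<inter> space M) \<omega>)"
        unfolding set_lebesgue_integral_def
        by (rule Bochner_Integration.integral_cong) (auto simp: indicator_def)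
      also have "\<dots> = (LINT \<omega>:Z -` C \<inter> space M|M. c x \<omega>)"
        unfolding c_def by (rule G.real_cond_exp_intA[OF int D])
      also have "\<dots> = (LINT \<omega>:Z -` C \<inter> space M|M. F (Z \<omega>) x)"
        unfolding set_lebesgue_integral_def
      proof (rule integral_cong_AE)
        have [measurable]: "c x \<in> borel_measurable M" unfolding c_def by (rule borel_measurable_cond_exp2)
        show "(\<lambda>\<omega>. indicator (Z -` C \<inter> space M) \<omega> *\<^sub>R c x \<omega>) \<in> borel_measurable M" by measurable
        show "(\<lambda>\<omega>. indicator (Z -` C \<inter> space M) \<omega> *\<^sub>R F (Z \<omega>) x) \<in> borel_measurable M" by measurable
        show "AE \<omega> in M. indicator (Z -` C \<inter> space M) \<omega> *\<^sub>R c x \<omega> = indicator (Z -` C \<inter> space M) \<omega> *\<^sub>R F (Z \<omega>) x"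
          using F_c[of x] by eventually_elim simp
      qed
      also have "ennreal \<dots> = (\<integral>\<^sup>+\<omega>. ennreal (indicator (Z -` C \<inter> space M) \<omega> *\<^sub>R F (Z \<omega>) x) \<partial>M)"
        unfolding set_lebesgue_integral_def using F01
        by (intro nn_integral_eq_integral[symmetric] integrable_mult_indicator
            integrable_const_bound[where B = 1]) auto
      also have "\<dots> = (\<integral>\<^sup>+\<omega>. emeasure (\<kappa> (Z \<omega>)) B * indicator C (Z \<omega>) \<partial>M)"
        by (rule nn_integral_cong) (auto simp: B cdf indicator_def)
      also have "\<dots> = emeasure (?M \<bind> (\<lambda>\<omega>. \<kappa> (Z \<omega>))) B"
        by (rule bind[symmetric]) (simp add: B)
      finally show "emeasure (distr ?M borel Y) B = emeasure (?M \<bind> (\<lambda>\<omega>. \<kappa> (Z \<omega>))) B" .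
    qed auto
    then show "emeasure M {\<omega> \<in> space M. Y \<omega> \<in> A \<and> Z \<omega> \<in> C} =
        (\<integral>\<^sup>+\<omega>. emeasure (\<kappa> (Z \<omega>)) A * indicator C (Z \<omega>) \<partial>M)"
      using distr[OF A] bind[OF A] by simp
  qed
  then show ?thesis by (rule that)
qed

text \<open>\<open>arctan\<close> compresses \<open>Y\<close> into a bounded range, where
  \<open>2\<close> exceeds \<open>pi / 2\<close> because \<open>pi < 4\<close>; pushing the kernel
  forward along \<open>tan\<close> undoes this.\<close>

theorem (in prob_space) cond_dist_exists:
  fixes Y :: "'a \<Rightarrow> real"
  assumes Y[measurable]: "Y \<in> borel_measurable M" and Z[measurable]: "Z \<in> M \<rightarrow>\<^sub>M L"
  obtains \<kappa> where "cond_dist M Y borel Z L \<kappa>"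
proof -
  have "\<bar>arctan y\<bar> \<le> 2" for y using arctan_bounded[of y] pi_less_4 by linarith
  moreover have W[measurable]: "(\<lambda>\<omega>. arctan (Y \<omega>)) \<in> borel_measurable M" by measurable
  ultimately obtain \<kappa> where \<kappa>: "cond_dist M (\<lambda>\<omega>. arctan (Y \<omega>)) borel Z L \<kappa>"
    using cond_dist_exists_bounded[OF _ Z] by blast
  have "tan \<in> borel_measurable (borel :: real measure)"
    unfolding tan_def by measurable
  from cond_dist_compose[OF \<kappa> W Z this] show ?thesis by (intro that) (simp add: tan_arctan)
qed


section \<open>Consequences of the Markov property\<close>

lemma global_granger_markovD:
  assumes "global_granger_markov M X G" "A \<inter> B = {}" "A \<inter> C = {}" "B \<inter> C = {}"
  shows "(\<And>x y es. x \<in> A \<Longrightarrow> y \<in> B \<Longrightarrow> is_path G x es y \<Longrightarrow> pointing es \<Longrightarrow> m_blocked (B \<union> C) es) \<Longrightarrow>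
      cond_indep M X (B \<times> {u + 1}) (A \<times> {..u}) ((B \<union> C) \<times> {..u})"
    and "(\<And>x y es. x \<in> A \<Longrightarrow> y \<in> B \<Longrightarrow> is_path G x es y \<Longrightarrow> bi_pointing es \<Longrightarrow> m_blocked (A \<union> B \<union> C) es) \<Longrightarrow>
      (\<And>x y. x \<in> A \<Longrightarrow> y \<in> B \<Longrightarrow> (x, y) \<notin> undirected G) \<Longrightarrow>
      cond_indep M X (A \<times> {u + 1}) (B \<times> {u + 1}) ((A \<union> B \<union> C) \<times> {..u})"
  using assms(1)[unfolded global_granger_markov_def, rule_format, of A B C] assms(2-4)
  by (auto simp: granger_noncausal_def contemp_independent_def)

text \<open>No vertex outside the ancestors of \<open>b\<close> helps to predict them one step
  ahead. The steps are chained by contraction, with the past of all variables up to \<open>t\<close>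
  kept as the first family; the outcome is symmetrised.\<close>

lemma cond_indep_future_ancestors:
  assumes ts: "time_series M X" and gm: "global_granger_markov M X G"
  shows "cond_indep M X (an G b \<times> {t<..t + int h}) (UNIV \<times> {..t}) (an G b \<times> {..t})"
proof -
  let ?A = "an G b"
  have step: "cond_indep M X (UNIV \<times> {..t}) (?A \<times> {u + 1}) (?A \<times> {..u})" if "t \<le> u" for u
  proof -
    have "cond_indep M X (?A \<times> {u + 1}) ((- ?A) \<times> {..u}) ((?A \<union> {}) \<times> {..u})"
      using pointing_to_ancestors_blocked[of _ G b]
      by (intro global_granger_markovD(1)[OF gm]) auto
    then have "cond_indep M X (?A \<times> {u + 1}) (UNIV \<times> {..t}) (?A \<times> {..u})"
      using that by (elim cond_indep_between[OF ts]) auto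
    then show ?thesis by (rule cond_indep_sym)
  qed
  show ?thesis
  proof (induction h)
    case 0
    show ?case
      by (rule cond_indep_between[OF ts cond_indep_sym[OF step[of t]]]) auto
  next
    case (Suc h)
    have eq: "?A \<times> {t<..t + int h} \<union> ?A \<times> {..t} = ?A \<times> {..t + int h}" by auto
    have "cond_indep M X (UNIV \<times> {..t}) (?A \<times> {t + int h + 1} \<union> ?A \<times> {t<..t + int h}) (?A \<times> {..t})"
      by (rule cond_indep_contraction[OF ts cond_indep_sym[OF Suc]]) (auto simp: eq intro: step)
    moreover have "?A \<times> {t + int h + 1} \<union> ?A \<times> {t<..t + int h} = ?A \<times> {t<..t + int (Suc h)}" by auto
    ultimately show ?case using cond_indep_sym by metis
  qed
qed

lemma cond_indep_back_door:
  assumes ts: "time_series M X" and G: "mixed_graph G" and gm: "global_granger_markov M X G"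
    and aS: "a \<in> S" and bS: "b \<in> S"
    and blocked: "\<forall>v\<in>an G b. \<forall>es. is_path G a es v \<and> pointing es \<and> back_door es \<longrightarrow> m_blocked S es"
  shows "cond_indep M X {(a, t)} ((an G b - S) \<times> {..t}) (S \<times> {..t - 1} \<union> (S - {a}) \<times> {t})"
proof -
  define U where "U = an G b - S"
  define T where "T = collider_reachable G S a"
  have T: "a \<in> T" "T \<subseteq> S" using aS by (auto simp: T_def collider_reachable_def)
  \<comment> \<open>Granger noncausality from \<open>U\<close> to \<open>T\<close> with the
    remaining vertices \<open>S - T\<close> as third set, taken at time \<open>t - 1\<close>; hence
    the index \<open>t - 1 + 1\<close>.\<close>
  have "cond_indep M X (T \<times> {t - 1 + 1}) (U \<times> {..t - 1}) ((T \<union> (S - T)) \<times> {..t - 1})"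
  proof (rule global_granger_markovD(1)[OF gm])
    fix x y es assume "x \<in> U" "y \<in> T" "is_path G x es y" "pointing es"
    then have "m_blocked S es"
      unfolding U_def T_def using pointing_into_collider_reachable_blocked[OF G aS bS blocked] by blast
    then show "m_blocked (T \<union> (S - T)) es" using T by (simp add: Un_absorb1)
  qed (use T U_def in auto)
  then have 1: "cond_indep M X (T \<times> {t}) (U \<times> {..t - 1}) (S \<times> {..t - 1})"
    using T by (simp add: Un_absorb1)
  have SU: "T \<union> (U \<union> (S - T)) \<union> {} = S \<union> U" using T by auto
  \<comment> \<open>Contemporaneous independence, where \<open>U\<close> and \<open>S - T\<close>
    together form the second set and the third is empty, so that the conditioning past is that of
    \<open>S \<union> U\<close>.\<close>
  have "cond_indep M X (T \<times> {t - 1 + 1}) ((U \<union> (S - T)) \<times> {t - 1 + 1}) ((T \<union> (U \<union> (S - T)) \<union> {}) \<times> {..t - 1})"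
  proof (rule global_granger_markovD(2)[OF gm], goal_cases)
    case (4 x y es)
    then show ?case
      unfolding SU unfolding U_def T_def
      using bi_pointing_collider_reachable_blocked[OF G aS bS blocked] by blast
  next
    case (5 x y)
    then show ?case
      unfolding U_def T_def using no_undirected_from_collider_reachable[OF G aS bS blocked] by blast
  qed (use T U_def in auto)
  then have 2: "cond_indep M X (T \<times> {t}) ((U \<union> (S - T)) \<times> {t}) (U \<times> {..t - 1} \<union> S \<times> {..t - 1})"
    unfolding SU by (simp add: Un_commute Sigma_Un_distrib1)
  let ?J = "(U \<union> (S - T)) \<times> {t} \<union> U \<times> {..t - 1}"
  have "cond_indep M X (T \<times> {t}) ?J (S \<times> {..t - 1})"
    by (rule cond_indep_contraction[OF ts 1 2])
  then have "cond_indep M X ?J (T \<times> {t}) (S \<times> {..t - 1})"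
    by (rule cond_indep_sym)
  \<comment> \<open>Weak union moves the variables of \<open>T - {a}\<close> at time
    \<open>t\<close> into the condition. It acts on the second family, hence the swap to the front
    and back. The last application treats \<open>S - T\<close> likewise.\<close>
  then have "cond_indep M X ?J (T \<times> {t}) (S \<times> {..t - 1} \<union> (T - {a}) \<times> {t})"
    using T by (elim cond_indep_between[OF ts]) auto
  then have "cond_indep M X (T \<times> {t}) ?J (S \<times> {..t - 1} \<union> (T - {a}) \<times> {t})"
    by (rule cond_indep_sym)
  then have "cond_indep M X {(a, t)} (U \<times> {..t}) (S \<times> {..t - 1} \<union> (S - {a}) \<times> {t})"
    using T by (elim cond_indep_between[OF ts]) auto
  then show ?thesis by (simp add: U_def)
qed

lemma borel_measurable_info_component:
  assumes "(c, u) \<in> J" shows "X c u \<in> borel_measurable (info M X J)"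
proof -
  have "(\<lambda>\<omega>. obs X J \<omega> (c, u)) \<in> borel_measurable (info M X J)"
    by (rule measurable_compose[OF measurable_obs_info measurable_component_singleton[OF assms]])
  then show ?thesis using assms by (simp add: obs_apply)
qed

lemma cond_dist_of_cond_indep:
  assumes ts: "time_series M X" and ci: "cond_indep M X I J K"
    and Y: "Y \<in> info M X I \<rightarrow>\<^sub>M N"
    and cd: "cond_dist M Y N (obs X K) (path_space K) \<kappa>"
    and L: "L = J \<union> K"
  shows "cond_dist M Y N (obs X L) (path_space L) (\<lambda>z. \<kappa> (restrict z K))"
  unfolding cond_dist_def
proof (intro conjI ballI)
  have "\<kappa> \<in> path_space K \<rightarrow>\<^sub>M prob_algebra N" using cd by (simp add: cond_dist_def)
  then show "(\<lambda>z. \<kappa> (restrict z K)) \<in> path_space L \<rightarrow>\<^sub>M prob_algebra N"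
    using L by (auto intro: measurable_compose[OF measurable_restrict_subset])
  fix A assume "A \<in> sets N"
  then have "AE \<omega> in M. real_cond_exp M (info M X K) (indicator (Y -` A \<inter> space M)) \<omega> = measure (\<kappa> (obs X K \<omega>)) A"
    and "Y -` A \<inter> space M \<in> sets (info M X I)"
    using cd measurable_sets[OF Y, of A] by (auto simp: cond_dist_def)
  moreover from this(2) have "AE \<omega> in M. real_cond_exp M (info M X L) (indicator (Y -` A \<inter> space M)) \<omega> =
      real_cond_exp M (info M X K) (indicator (Y -` A \<inter> space M)) \<omega>"
    using ci unfolding cond_indep_iff[OF ts] L by auto
  ultimately have "AE \<omega> in M. real_cond_exp M (info M X L) (indicator (Y -` A \<inter> space M)) \<omega> = measure (\<kappa> (obs X K \<omega>)) A"
    by auto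
  then show "AE \<omega> in M. real_cond_exp M (info M X L) (indicator (Y -` A \<inter> space M)) \<omega> =
      measure (\<kappa> (restrict (obs X L \<omega>) K)) A"
    using restrict_obs[of K L X] L by auto
qed

text \<open>\<open>I\<close> and \<open>J\<close> may overlap, so this is no binary product. Apply
  \<open>sets_info_Un\<close> to the coordinate process on the path space itself, whose observations
  are restrictions.\<close>

lemma sets_path_space_Un:
  fixes I J :: "('v \<times> int) set"
  shows "sets (path_space (I \<union> J)) = sigma_sets (space (path_space (I \<union> J)))
    {{x \<in> space (path_space (I \<union> J)). restrict x I \<in> A \<and> restrict x J \<in> B} | A B.
      A \<in> sets (path_space I) \<and> B \<in> sets (path_space J)}"
proof -
  define X :: "'v \<Rightarrow> int \<Rightarrow> ('v \<times> int \<Rightarrow> real) \<Rightarrow> real" where "X c u x = x (c, u)" for c u x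
  let ?M = "path_space (I \<union> J)"
  have obs: "obs X K x = restrict x K" for K x
    by (auto simp: obs_def X_def fun_eq_iff)
  have "restrict x (I \<union> J) = x" if "x \<in> space ?M" for x
    using that by (auto simp: space_PiM PiE_def intro: extensional_restrict)
  then have "obs X (I \<union> J) -` A \<inter> space ?M = A" if "A \<in> sets ?M" for A
    using sets.sets_into_space[OF that] by (auto simp: obs)
  then have "sets ?M = sets (info ?M X (I \<union> J))"
    unfolding sets_info by auto
  also have "\<dots> = sigma_sets (space ?M) {{x \<in> space ?M. restrict x I \<in> A \<and> restrict x J \<in> B} | A B.
      A \<in> sets (path_space I) \<and> B \<in> sets (path_space J)}"
    unfolding sets_info_Un unfolding sets_info unfolding obs[abs_def]
  proof (intro arg_cong[where f = "sigma_sets (space ?M)"] equalityI subsetI; clarify)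
    fix A B assume "A \<in> sets (path_space I)" "B \<in> sets (path_space J)"
    then show "\<exists>A' B'. (\<lambda>x. restrict x I) -` A \<inter> space ?M \<inter> ((\<lambda>x. restrict x J) -` B \<inter> space ?M) =
        {x \<in> space ?M. restrict x I \<in> A' \<and> restrict x J \<in> B'} \<and> A' \<in> sets (path_space I) \<and> B' \<in> sets (path_space J)"
      by (intro exI[of _ A] exI[of _ B]) auto
  next
    fix A B assume "A \<in> sets (path_space I)" "B \<in> sets (path_space J)"
    then show "\<exists>A' B'. {x \<in> space ?M. restrict x I \<in> A \<and> restrict x J \<in> B} = A' \<inter> B' \<and>
        A' \<in> {(\<lambda>x. restrict x I) -` A \<inter> space ?M |A. A \<in> sets (path_space I)} \<and>
        B' \<in> {(\<lambda>x. restrict x J) -` A \<inter> space ?M |A. A \<in> sets (path_space J)}"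
      by (intro exI[of _ "(\<lambda>x. restrict x I) -` A \<inter> space ?M"] exI[of _ "(\<lambda>x. restrict x J) -` B \<inter> space ?M"]) auto
  qed
  finally show ?thesis .
qed

lemma Int_stable_path_space_Un:
  "Int_stable {{x \<in> \<Omega>. restrict x I \<in> A \<and> restrict x J \<in> B} | A B.
      A \<in> sets (path_space I) \<and> B \<in> sets (path_space J)}"
proof (rule Int_stableI, clarify)
  fix A B A' B'
  assume "A \<in> sets (path_space I)" "B \<in> sets (path_space J)" "A' \<in> sets (path_space I)" "B' \<in> sets (path_space J)"
  then show "\<exists>A'' B''. {x \<in> \<Omega>. restrict x I \<in> A \<and> restrict x J \<in> B} \<inter> {x \<in> \<Omega>. restrict x I \<in> A' \<and> restrict x J \<in> B'} =
      {x \<in> \<Omega>. restrict x I \<in> A'' \<and> restrict x J \<in> B''} \<and> A'' \<in> sets (path_space I) \<and> B'' \<in> sets (path_space J)"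
    by (intro exI[of _ "A \<inter> A'"] exI[of _ "B \<inter> B'"]) auto
qed

text \<open>The integral characterisation of a version involves only the joint law of
  \<open>Y\<close> and \<open>Z\<close>.\<close>

lemma cond_dist_cong_law:
  assumes M: "prob_space M" "Y \<in> M \<rightarrow>\<^sub>M N" "Z \<in> M \<rightarrow>\<^sub>M L" and M': "prob_space M'" "Y \<in> M' \<rightarrow>\<^sub>M N" "Z \<in> M' \<rightarrow>\<^sub>M L"
    and law: "distr M (N \<Otimes>\<^sub>M L) (\<lambda>\<omega>. (Y \<omega>, Z \<omega>)) = distr M' (N \<Otimes>\<^sub>M L) (\<lambda>\<omega>. (Y \<omega>, Z \<omega>))"
    and cd: "cond_dist M Y N Z L \<kappa>"
  shows "cond_dist M' Y N Z L \<kappa>"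
  unfolding prob_space.cond_dist_iff[OF M']
proof (intro conjI ballI)
  show \<kappa>: "\<kappa> \<in> L \<rightarrow>\<^sub>M prob_algebra N" using cd by (simp add: cond_dist_def)
  fix A C assume [measurable]: "A \<in> sets N" "C \<in> sets L"
  note [measurable] = M(2,3) M'(2,3) kernel_emeasure_measurable[OF \<kappa> \<open>A \<in> sets N\<close>]
  have e1: "emeasure K {\<omega> \<in> space K. Y \<omega> \<in> A \<and> Z \<omega> \<in> C} = emeasure (distr K (N \<Otimes>\<^sub>M L) (\<lambda>\<omega>. (Y \<omega>, Z \<omega>))) (A \<times> C)"
    if [measurable]: "Y \<in> K \<rightarrow>\<^sub>M N" "Z \<in> K \<rightarrow>\<^sub>M L" for K
    by (subst emeasure_distr) (auto intro!: arg_cong[where f = "emeasure K"])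
  have e2: "(\<integral>\<^sup>+\<omega>. emeasure (\<kappa> (Z \<omega>)) A * indicator C (Z \<omega>) \<partial>K) =
      (\<integral>\<^sup>+p. emeasure (\<kappa> (snd p)) A * indicator C (snd p) \<partial>distr K (N \<Otimes>\<^sub>M L) (\<lambda>\<omega>. (Y \<omega>, Z \<omega>)))"
    if [measurable]: "Y \<in> K \<rightarrow>\<^sub>M N" "Z \<in> K \<rightarrow>\<^sub>M L" for K
    by (subst nn_integral_distr) auto
  have "emeasure M {\<omega> \<in> space M. Y \<omega> \<in> A \<and> Z \<omega> \<in> C} =
      (\<integral>\<^sup>+\<omega>. emeasure (\<kappa> (Z \<omega>)) A * indicator C (Z \<omega>) \<partial>M)"
    using cd unfolding prob_space.cond_dist_iff[OF M] by simp
  then show "emeasure M' {\<omega> \<in> space M'. Y \<omega> \<in> A \<and> Z \<omega> \<in> C} =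
      (\<integral>\<^sup>+\<omega>. emeasure (\<kappa> (Z \<omega>)) A * indicator C (Z \<omega>) \<partial>M')"
    unfolding e1[OF M(2,3)] e2[OF M(2,3)] e1[OF M'(2,3)] e2[OF M'(2,3)] law .
qed


section \<open>The two regimes\<close>

lemma null_sets_PiM_lborel_fixed_component:
  assumes "finite I" "i \<in> I"
  shows "{x \<in> space (\<Pi>\<^sub>M j\<in>I. lborel). x i = (c::real)} \<in> null_sets (\<Pi>\<^sub>M j\<in>I. lborel)"
proof -
  interpret product_sigma_finite "\<lambda>_. lborel :: real measure" ..
  let ?E = "\<lambda>j. if j = i then {c} else UNIV"
  have eq: "{x \<in> space (\<Pi>\<^sub>M j\<in>I. lborel). x i = c} = Pi\<^sub>E I ?E"
    using assms(2) by (auto simp: space_PiM PiE_iff extensional_def split: if_splits)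
  have "emeasure (\<Pi>\<^sub>M j\<in>I. lborel) (Pi\<^sub>E I ?E) = (\<Prod>j\<in>I. emeasure lborel (?E j))"
    by (rule emeasure_PiM[OF assms(1)]) auto
  also have "\<dots> = 0" using assms by (intro prod_zero) auto
  finally show ?thesis
    unfolding eq using assms(1) by (intro null_setsI sets_PiM_I_finite) auto
qed

text \<open>Given a past \<open>z\<close>, the event is the hyperplane
  \<open>y (a, t) = g z\<close>, which is null for product Lebesgue measure and so for the
  conditional law; integrating over the past keeps it null. Thus a prescribed value is almost surely
  not met in the idle regime.\<close>

lemma ac_conditionals_avoid_function_of_past:
  fixes X :: "'v::finite \<Rightarrow> int \<Rightarrow> 'w \<Rightarrow> real"
  assumes ts: "time_series M X" and ac: "ac_conditionals M X"
    and g[measurable]: "g \<in> borel_measurable (path_space (UNIV \<times> {..t - 1}))"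
  shows "AE \<omega> in M. X a t \<omega> \<noteq> g (obs X (UNIV \<times> {..t - 1}) \<omega>)"
proof -
  interpret prob_space M using ts by (simp add: time_series_def)
  let ?V = "UNIV \<times> {t} :: ('v \<times> int) set" and ?Z = "obs X (UNIV \<times> {..t - 1})"
  let ?L = "path_space (UNIV \<times> {..t - 1}) :: ('v \<times> int \<Rightarrow> real) measure" and ?N = "path_space (UNIV \<times> {t}) :: ('v \<times> int \<Rightarrow> real) measure"
  note [measurable] = measurable_obs[OF ts]
  obtain \<kappa> where \<kappa>: "cond_dist M (obs X ?V) ?N ?Z ?L \<kappa>"
      "AE \<omega> in M. absolutely_continuous (\<Pi>\<^sub>M j\<in>?V. lborel) (\<kappa> (?Z \<omega>))"
    using ac[unfolded ac_conditionals_def, rule_format, of "t - 1"] by auto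
  let ?B = "{p \<in> space (?L \<Otimes>\<^sub>M ?N). snd p (a, t) = g (fst p)}"
  have comp[measurable]: "(\<lambda>y. y (a, t)) \<in> borel_measurable ?N"
    by (rule measurable_component_singleton) simp
  have B: "?B \<in> sets (?L \<Otimes>\<^sub>M ?N)" by measurable
  have "emeasure M {\<omega> \<in> space M. (?Z \<omega>, obs X ?V \<omega>) \<in> ?B} = (\<integral>\<^sup>+\<omega>. emeasure (\<kappa> (?Z \<omega>)) (Pair (?Z \<omega>) -` ?B) \<partial>M)"
    by (rule cond_dist_joint[OF \<kappa>(1) _ _ B]) measurable
  also have "\<dots> = (\<integral>\<^sup>+\<omega>. 0 \<partial>M)"
  proof (rule nn_integral_cong_AE)
    show "AE \<omega> in M. emeasure (\<kappa> (?Z \<omega>)) (Pair (?Z \<omega>) -` ?B) = 0"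
      using \<kappa>(2)
    proof eventually_elim
      case (elim \<omega>)
      have "Pair (?Z \<omega>) -` ?B = {y \<in> space (\<Pi>\<^sub>M j\<in>?V. lborel). y (a, t) = g (?Z \<omega>)}"
        using obs_in_path_space[of X "UNIV \<times> {..t - 1}" \<omega>] by (auto simp: space_pair_measure space_PiM)
      also have "\<dots> \<in> null_sets (\<Pi>\<^sub>M j\<in>?V. lborel)"
        by (rule null_sets_PiM_lborel_fixed_component) auto
      finally show ?case using elim by (auto simp: absolutely_continuous_def)
    qed
  qed
  finally have "emeasure M {\<omega> \<in> space M. (?Z \<omega>, obs X ?V \<omega>) \<in> ?B} = 0" by simp
  moreover have "{\<omega> \<in> space M. (?Z \<omega>, obs X ?V \<omega>) \<in> ?B} = {\<omega> \<in> space M. X a t \<omega> = g (?Z \<omega>)}"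
    using obs_in_path_space[of X "UNIV \<times> {..t - 1}"] obs_in_path_space[of X ?V]
    by (auto simp: space_pair_measure obs_apply)
  ultimately have "emeasure M {\<omega> \<in> space M. X a t \<omega> = g (?Z \<omega>)} = 0" by simp
  moreover have "{\<omega> \<in> space M. X a t \<omega> = g (?Z \<omega>)} \<in> sets M"
  proof -
    have [measurable]: "X a t \<in> borel_measurable M" using ts by (simp add: time_series_def)
    show ?thesis by measurable
  qed
  ultimately show ?thesis by (intro AE_I[where N = "{\<omega> \<in> space M. X a t \<omega> = g (?Z \<omega>)}"]) auto
qed

text \<open>Over each past \<open>z\<close>, the graph of \<open>g\<close> has the slice
  \<open>{g z}\<close>, to which the point mass assigns \<open>1\<close>.\<close>

lemma cond_law_point_mass:
  assumes ts: "time_series M X"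
    and g[measurable]: "g \<in> borel_measurable (path_space (UNIV \<times> {..t - 1}))"
    and cl: "cond_law_given_past M X a t (\<lambda>p. return borel (g p))"
  shows "AE \<omega> in M. X a t \<omega> = g (obs X (UNIV \<times> {..t - 1}) \<omega>)"
proof -
  interpret prob_space M using ts by (simp add: time_series_def)
  let ?Z = "obs X (UNIV \<times> {..t - 1})" and ?L = "path_space (UNIV \<times> {..t - 1})"
  note [measurable] = measurable_obs[OF ts]
  have Y[measurable]: "X a t \<in> borel_measurable M" using ts by (simp add: time_series_def)
  let ?B = "{p \<in> space (?L \<Otimes>\<^sub>M borel). snd p = g (fst p)}"
  have B: "?B \<in> sets (?L \<Otimes>\<^sub>M borel)" by measurable
  have "emeasure M {\<omega> \<in> space M. (?Z \<omega>, X a t \<omega>) \<in> ?B} =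
      (\<integral>\<^sup>+\<omega>. emeasure (return borel (g (?Z \<omega>))) (Pair (?Z \<omega>) -` ?B) \<partial>M)"
    using cl unfolding cond_law_given_past_def by (rule cond_dist_joint[OF _ Y _ B]) measurable
  also have "\<dots> = (\<integral>\<^sup>+\<omega>. 1 \<partial>M)"
  proof (rule nn_integral_cong)
    fix \<omega>
    have "Pair (?Z \<omega>) -` ?B = {g (?Z \<omega>)}"
      using obs_in_path_space[of X "UNIV \<times> {..t - 1}" \<omega>] by (auto simp: space_pair_measure)
    then show "emeasure (return borel (g (?Z \<omega>))) (Pair (?Z \<omega>) -` ?B) = 1" by simp
  qed
  also have "\<dots> = 1" by (simp add: emeasure_space_1)
  finally have "prob {\<omega> \<in> space M. (?Z \<omega>, X a t \<omega>) \<in> ?B} = 1" by (simp add: emeasure_eq_measure)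
  moreover have "{\<omega> \<in> space M. (?Z \<omega>, X a t \<omega>) \<in> ?B} = {\<omega> \<in> space M. X a t \<omega> = g (?Z \<omega>)}"
    using obs_in_path_space[of X "UNIV \<times> {..t - 1}"] by (auto simp: space_pair_measure)
  ultimately show ?thesis by (subst (asm) prob_Collect_eq_1) auto
qed

text \<open>The distribution drawn from depends on the past of \<open>C \<subseteq> S\<close> only,
  so given the past of \<open>S\<close> the draw is independent of the whole past. External
  randomisation adds the simultaneous values by contraction, and weak union moves those in
  \<open>S\<close> into the condition.\<close>

lemma intervened_Random_cond_indep:
  assumes ts: "time_series M X" and iv: "intervened M X a t (Random C q)" and CS: "C \<subseteq> S" and aS: "a \<in> S"
    and U: "a \<notin> U"
  shows "cond_indep M X {(a, t)} (U \<times> {..t}) (S \<times> {..t - 1} \<union> (S - {a}) \<times> {t})"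
proof -
  interpret prob_space M using ts by (simp add: time_series_def)
  let ?V = "UNIV \<times> {..t - 1}" and ?S = "S \<times> {..t - 1}" and ?C = "C \<times> {..t - 1}"
  interpret info: finite_measure_subalgebra M "info M X J" for J
    by (rule finite_measure_subalgebra_info[OF ts])
  have q: "q \<in> path_space ?C \<rightarrow>\<^sub>M prob_algebra borel"
    and cd: "cond_dist M (X a t) borel (obs X ?V) (path_space ?V) (\<lambda>p. q (restrict p ?C))"
    and ci: "cond_indep M X {(a, t)} ((- {a}) \<times> {t}) ?V"
    using iv by (auto simp: cond_law_given_past_def)
  have "cond_indep M X {(a, t)} ?V ?S"
    unfolding cond_indep_iff[OF ts]
  proof
    fix A assume A: "A \<in> sets (info M X {(a, t)})"
    then have AM: "A \<in> sets M" using info_sets[OF ts] by auto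
    have "{X c u -` B \<inter> space M |c u B. (c, u) \<in> {(a, t)} \<and> B \<in> sets borel} = {X a t -` B \<inter> space M |B. B \<in> sets borel}"
      by auto
    then have "A \<in> sets (vimage_algebra (space M) (X a t) borel)"
      using A unfolding sets_info_eq_sigma_sets sets_vimage_algebra by simp
    then obtain B where B: "B \<in> sets borel" "A = X a t -` B \<inter> space M"
      by (subst (asm) sets_vimage_algebra2) auto
    let ?f = "\<lambda>\<omega>. measure (q (obs X ?C \<omega>)) B"
    have 1: "AE \<omega> in M. real_cond_exp M (info M X ?V) (indicator A) \<omega> = ?f \<omega>"
    proof -
      have "?C \<subseteq> ?V" by auto
      from restrict_obs[OF this, of X] show ?thesis using cd B by (simp add: cond_dist_def)
    qed
    \<comment> \<open>This version of the conditional probability given the full past is already a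
      function of the past of \<open>S\<close>, so conditioning down to \<open>S\<close> leaves it
      unchanged.\<close>
    have fS: "?f \<in> borel_measurable (info M X ?S)"
    proof (rule measurable_from_subalg[OF subalgebra_info_info[of ?C]])
      show "?f \<in> borel_measurable (info M X ?C)"
        by (rule measurable_compose[OF measurable_obs_info kernel_emeasure_measurable(2)[OF q B(1)]])
    qed (use CS in auto)
    have SV: "?S \<subseteq> ?V" by auto
    have "AE \<omega> in M. real_cond_exp M (info M X ?S) (indicator A) \<omega> =
        real_cond_exp M (info M X ?S) (real_cond_exp M (info M X ?V) (indicator A)) \<omega>"
      using cprob_nested[OF ts _ AM, of ?S ?V, OF SV] by auto
    moreover have "AE \<omega> in M. real_cond_exp M (info M X ?S) (real_cond_exp M (info M X ?V) (indicator A)) \<omega> =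
        real_cond_exp M (info M X ?S) ?f \<omega>"
      using 1 measurable_from_subalg[OF subalgebra_info[OF ts] fS]
      by (intro info.real_cond_exp_cong) (auto intro: borel_measurable_cond_exp2)
    moreover have "AE \<omega> in M. real_cond_exp M (info M X ?S) ?f \<omega> = ?f \<omega>"
    proof (rule info.real_cond_exp_F_meas[OF _ fS])
      show "integrable M ?f"
      proof (rule integrable_const_bound[where B = 1])
        have "prob_space (q (obs X ?C \<omega>))" for \<omega>
          using kernel_prob_space(1)[OF q obs_in_path_space] .
        then show "AE \<omega> in M. norm (?f \<omega>) \<le> 1"
          by (auto simp: prob_space.prob_le_1)
        show "?f \<in> borel_measurable M" by (rule measurable_from_subalg[OF subalgebra_info[OF ts] fS])
      qed
    qed
    moreover have "?V \<union> ?S = ?V" by auto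
    ultimately show "AE \<omega> in M. real_cond_exp M (info M X (?V \<union> ?S)) (indicator A) \<omega> =
        real_cond_exp M (info M X ?S) (indicator A) \<omega>"
      using 1 by auto
  qed
  moreover have "?V \<union> ?S = ?V" by auto
  ultimately have "cond_indep M X {(a, t)} ((- {a}) \<times> {t} \<union> ?V) ?S"
    using ci by (intro cond_indep_contraction[OF ts]) auto
  then show ?thesis
    using U by (elim cond_indep_between[OF ts]) (auto simp: less_le)
qed

text \<open>
  In both regimes, \<open>obs X I\<close> is independent of \<open>X\<^sub>a(t)\<close> given \<open>obs X K\<close>, with the same conditional law. So
  a density \<open>\<delta>\<close> between the two laws of \<open>obs X L\<close> off \<open>N\<close> is one between the laws of the larger family as well.
\<close>

lemma regime_density:
  fixes X :: "'v \<Rightarrow> int \<Rightarrow> 'w \<Rightarrow> real"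
  assumes ts: "time_series M X" "time_series M' X"
    and J: "K \<subseteq> I" and L: "L = K \<union> {(a, t)}"
    and ci: "cond_indep M X I {(a, t)} K" "cond_indep M' X I {(a, t)} K"
    and law: "distr M (path_space I) (obs X I) = distr M' (path_space I) (obs X I)"
    and N[measurable]: "N \<in> sets (path_space L)"
    and ac: "\<forall>C\<in>sets (path_space L). (AE \<omega> in M. obs X L \<omega> \<notin> C) \<longrightarrow>
        (AE \<omega> in M'. obs X L \<omega> \<in> C \<longrightarrow> obs X L \<omega> \<in> N)"
  shows "\<exists>\<delta>\<in>borel_measurable (path_space L). \<forall>f\<in>borel_measurable (path_space (I \<union> {(a, t)})).
      (\<integral>\<^sup>+\<omega>. f (obs X (I \<union> {(a, t)}) \<omega>) * indicator (- N) (obs X L \<omega>) \<partial>M') =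
      (\<integral>\<^sup>+\<omega>. f (obs X (I \<union> {(a, t)}) \<omega>) * \<delta> (obs X L \<omega>) \<partial>M)"
proof -
  interpret M: prob_space M using ts by (simp add: time_series_def)
  interpret M': prob_space M' using ts by (simp add: time_series_def)
  note [measurable] = measurable_obs[OF ts(1)] measurable_obs[OF ts(2)]
  let ?J = "I \<union> {(a, t)}"
  have LJ: "L \<subseteq> ?J" using J L by auto
  have N'[measurable]: "indicator (- N) \<in> borel_measurable (path_space L)"
  proof -
    have "(\<lambda>x. 1 - indicator N x :: ennreal) \<in> borel_measurable (path_space L)" by measurable
    moreover have "(\<lambda>x. 1 - indicator N x :: ennreal) = indicator (- N)"
      by (auto simp: indicator_def)
    ultimately show ?thesis by simp
  qed
  \<comment> \<open>The interventional law is restricted to the complement of \<open>N\<close>,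
    where absolute continuity with respect to the idle law is available.\<close>
  let ?\<mu> = "distr M (path_space L) (obs X L)" and ?\<mu>' = "density (distr M' (path_space L) (obs X L)) (indicator (- N))"
  interpret \<mu>: prob_space ?\<mu> by (rule M.prob_space_distr) measurable
  have em': "emeasure ?\<mu>' C = (\<integral>\<^sup>+\<omega>. indicator C (obs X L \<omega>) * indicator (- N) (obs X L \<omega>) \<partial>M')"
    if [measurable]: "C \<in> sets (path_space L)" for C
    by (subst emeasure_density) (simp_all add: nn_integral_distr mult.commute)
  have "absolutely_continuous ?\<mu> ?\<mu>'"
    unfolding absolutely_continuous_def
  proof
    fix C assume "C \<in> null_sets ?\<mu>"
    then have C[measurable]: "C \<in> sets (path_space L)" and 0: "emeasure ?\<mu> C = 0" by auto
    have "emeasure M {\<omega> \<in> space M. obs X L \<omega> \<in> C} = 0"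
      using 0 by (simp add: emeasure_distr vimage_def Int_def conj_commute)
    then have "AE \<omega> in M. obs X L \<omega> \<notin> C"
      by (intro AE_I[where N = "{\<omega> \<in> space M. obs X L \<omega> \<in> C}"]) auto
    from ac[rule_format, OF C this] have "(\<integral>\<^sup>+\<omega>. indicator C (obs X L \<omega>) * indicator (- N) (obs X L \<omega>) \<partial>M') = (\<integral>\<^sup>+\<omega>. 0 \<partial>M')"
      by (intro nn_integral_cong_AE) (auto simp: indicator_def)
    then show "C \<in> null_sets ?\<mu>'" using C by (intro null_setsI) (simp_all add: em')
  qed
  then obtain \<delta> where \<delta>[measurable]: "\<delta> \<in> borel_measurable ?\<mu>" and \<delta>_eq: "density ?\<mu> \<delta> = ?\<mu>'"
    using \<mu>.Radon_Nikodym[of ?\<mu>'] by auto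
  then have \<delta>_meas[measurable]: "\<delta> \<in> borel_measurable (path_space L)" by simp
  have \<delta>_int: "(\<integral>\<^sup>+\<omega>. g (obs X L \<omega>) * indicator (- N) (obs X L \<omega>) \<partial>M') = (\<integral>\<^sup>+\<omega>. g (obs X L \<omega>) * \<delta> (obs X L \<omega>) \<partial>M)"
    if [measurable]: "g \<in> borel_measurable (path_space L)" for g
  proof -
    have "(\<integral>\<^sup>+x. g x \<partial>?\<mu>') = (\<integral>\<^sup>+x. g x \<partial>density ?\<mu> \<delta>)" using \<delta>_eq by simp
    then show ?thesis by (simp add: nn_integral_density nn_integral_distr mult.commute)
  qed
  let ?\<nu>' = "distr (density M' (\<lambda>\<omega>. indicator (- N) (obs X L \<omega>))) (path_space ?J) (obs X ?J)"
  let ?\<nu> = "distr (density M (\<lambda>\<omega>. \<delta> (obs X L \<omega>))) (path_space ?J) (obs X ?J)"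
  have em: "emeasure (distr (density Q (\<lambda>\<omega>. d (obs X L \<omega>))) (path_space ?J) (obs X ?J)) D =
      (\<integral>\<^sup>+\<omega>. indicator D (obs X ?J \<omega>) * d (obs X L \<omega>) \<partial>Q)"
    if "time_series Q X" and [measurable]: "d \<in> borel_measurable (path_space L)" "D \<in> sets (path_space ?J)" for Q D d
  proof -
    note [measurable] = measurable_obs[OF that(1)]
    show ?thesis
      by (subst emeasure_distr, measurable, subst emeasure_density, measurable, rule nn_integral_cong)
        (auto simp: indicator_def)
  qed
  have \<nu>_eq: "?\<nu>' = ?\<nu>"
  proof (rule measure_eqI_generator_eq[OF Int_stable_path_space_Un[of "space (path_space ?J)" I "{(a, t)}"]])
    let ?E = "{{x \<in> space (path_space ?J). restrict x I \<in> A \<and> restrict x {(a, t)} \<in> B} | A B.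
      A \<in> sets (path_space I) \<and> B \<in> sets (path_space {(a, t)})}"
    show "?E \<subseteq> Pow (space (path_space ?J))" by auto
    show "sets ?\<nu>' = sigma_sets (space (path_space ?J)) ?E" "sets ?\<nu> = sigma_sets (space (path_space ?J)) ?E"
      using sets_path_space_Un[of I "{(a, t)}"] by simp_all
    have "space (path_space ?J) = {x \<in> space (path_space ?J). restrict x I \<in> space (path_space I) \<and>
        restrict x {(a, t)} \<in> space (path_space {(a, t)})}"
      by (auto simp: space_PiM)
    then have "space (path_space ?J) \<in> ?E" using sets.top by blast
    then show "range (\<lambda>i::nat. space (path_space ?J)) \<subseteq> ?E" by blast
    show "(\<Union>i::nat. space (path_space ?J)) = space (path_space ?J)" by simp
    have "emeasure ?\<nu>' (space (path_space ?J)) \<le> (\<integral>\<^sup>+\<omega>. 1 \<partial>M')"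
      by (subst em[OF ts(2) N' sets.top], rule nn_integral_mono) (simp add: indicator_def)
    then show "emeasure ?\<nu>' (space (path_space ?J)) \<noteq> \<infinity>" for i :: nat
      by (auto simp: M'.emeasure_space_1 top_unique)
    fix D assume "D \<in> ?E"
    then obtain A B where D: "D = {x \<in> space (path_space ?J). restrict x I \<in> A \<and> restrict x {(a, t)} \<in> B}"
      and A[measurable]: "A \<in> sets (path_space I)" and B[measurable]: "B \<in> sets (path_space {(a, t)})" by auto
    have D_meas[measurable]: "D \<in> sets (path_space ?J)"
      unfolding D using measurable_restrict_subset[of I ?J "\<lambda>_. borel :: real measure"]
        measurable_restrict_subset[of "{(a, t)}" ?J "\<lambda>_. borel :: real measure"] A B
      by measurable
    \<comment> \<open>An event about \<open>obs X I\<close> is coded as a real variable, so that a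
      kernel exists; \<open>\<rho>\<close> below is the conditional probability of this event,
      namely of the value \<open>1\<close>.\<close>
    let ?Y = "\<lambda>\<omega>. indicator A (obs X I \<omega>) :: real"
    have Y[measurable]: "?Y \<in> borel_measurable M" "?Y \<in> borel_measurable M'" by measurable
    obtain \<kappa> where \<kappa>: "cond_dist M ?Y borel (obs X K) (path_space K) \<kappa>"
      using M.cond_dist_exists[OF Y(1), of "obs X K" "path_space K"] by auto
    have "distr M (borel \<Otimes>\<^sub>M path_space K) (\<lambda>\<omega>. (?Y \<omega>, obs X K \<omega>)) =
        distr M' (borel \<Otimes>\<^sub>M path_space K) (\<lambda>\<omega>. (?Y \<omega>, obs X K \<omega>))"
    proof -
      let ?h = "\<lambda>x. (indicator A x :: real, restrict x K)"
      have h[measurable]: "?h \<in> path_space I \<rightarrow>\<^sub>M borel \<Otimes>\<^sub>M path_space K"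
        using measurable_restrict_subset[OF J, of "\<lambda>_. borel :: real measure"] by measurable
      have "distr Q (borel \<Otimes>\<^sub>M path_space K) (\<lambda>\<omega>. (?Y \<omega>, obs X K \<omega>)) =
          distr (distr Q (path_space I) (obs X I)) (borel \<Otimes>\<^sub>M path_space K) ?h" if "time_series Q X" for Q
        by (subst distr_distr[OF h measurable_obs[OF that]]) (simp add: comp_def restrict_obs[OF J])
      then show ?thesis using law ts by simp
    qed
    \<comment> \<open>As \<open>K \<subseteq> I\<close>, the pair has the same law in both regimes,
      so one version serves both.\<close>
    then have \<kappa>': "cond_dist M' ?Y borel (obs X K) (path_space K) \<kappa>"
      using M.prob_space_axioms M'.prob_space_axioms \<kappa>
      by (elim cond_dist_cong_law[rotated 6]) (auto intro: Y measurable_obs ts)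
    have YI: "?Y \<in> borel_measurable (info Q X I)" for Q
      by (rule measurable_compose[OF measurable_obs_info]) measurable
    have L': "L = {(a, t)} \<union> K" using L by auto
    define \<rho> where "\<rho> z = emeasure (\<kappa> (restrict z K)) {1}" for z
    have \<kappa>_meas: "\<kappa> \<in> path_space K \<rightarrow>\<^sub>M prob_algebra borel" using \<kappa> by (simp add: cond_dist_def)
    have \<rho>[measurable]: "\<rho> \<in> borel_measurable (path_space L)"
      unfolding \<rho>_def
      by (rule measurable_compose[OF measurable_restrict_subset kernel_emeasure_measurable(1)[OF \<kappa>_meas]])
        (use L in auto)
    have key: "(\<integral>\<^sup>+\<omega>. g (obs X L \<omega>) * indicator A (obs X I \<omega>) \<partial>Q) = (\<integral>\<^sup>+\<omega>. g (obs X L \<omega>) * \<rho> (obs X L \<omega>) \<partial>Q)"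
      if "time_series Q X" "cond_indep Q X I {(a, t)} K" "cond_dist Q ?Y borel (obs X K) (path_space K) \<kappa>"
        and g: "g \<in> borel_measurable (path_space L)" for Q g
    proof -
      interpret Q: prob_space Q using that(1) by (simp add: time_series_def)
      note [measurable] = measurable_obs[OF that(1)]
      have "(\<integral>\<^sup>+\<omega>. g (obs X L \<omega>) * indicator {1} (?Y \<omega>) \<partial>Q) = (\<integral>\<^sup>+\<omega>. g (obs X L \<omega>) * \<rho> (obs X L \<omega>) \<partial>Q)"
        unfolding \<rho>_def
        by (rule Q.cond_dist_nn_integral[OF cond_dist_of_cond_indep[OF that(1,2) YI that(3) L'] _ _ _ g]) measurable
      moreover have "indicator {1} (?Y \<omega>) = (indicator A (obs X I \<omega>) :: ennreal)" for \<omega>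
        by (auto simp: indicator_def)
      ultimately show ?thesis by simp
    qed
    have B': "(\<lambda>z. indicator B (restrict z {(a, t)})) \<in> borel_measurable (path_space L)"
      by (rule measurable_compose[OF measurable_restrict_subset borel_measurable_indicator[OF B]]) (use L in auto)
    note [measurable] = B'
    have ind: "indicator D (obs X ?J \<omega>) = (indicator B (restrict (obs X L \<omega>) {(a, t)}) * indicator A (obs X I \<omega>) :: ennreal)" for \<omega>
      using obs_in_path_space[of X ?J \<omega>] restrict_obs[OF Un_upper1[of I "{(a, t)}"], of X \<omega>] restrict_obs[of "{(a, t)}" ?J X \<omega>]
        restrict_obs[of "{(a, t)}" L X \<omega>] L
      by (auto simp: D indicator_def)
    let ?b = "\<lambda>\<omega>. indicator B (restrict (obs X L \<omega>) {(a, t)}) :: ennreal"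
    \<comment> \<open>Replace the event given by \<open>A\<close> by \<open>\<rho>\<close>, which
      leaves only functions of \<open>obs X L\<close>, change the law there by
      \<open>\<delta>\<close>, and put the event back under the idle law.\<close>
    have "emeasure ?\<nu>' D = (\<integral>\<^sup>+\<omega>. (?b \<omega> * indicator (- N) (obs X L \<omega>)) * indicator A (obs X I \<omega>) \<partial>M')"
      unfolding em[OF ts(2) N' D_meas] ind by (simp add: mult_ac)
    also have "\<dots> = (\<integral>\<^sup>+\<omega>. (?b \<omega> * indicator (- N) (obs X L \<omega>)) * \<rho> (obs X L \<omega>) \<partial>M')"
      by (rule key[OF ts(2) ci(2) \<kappa>', of "\<lambda>z. indicator B (restrict z {(a, t)}) * indicator (- N) z"]) measurable
    also have "\<dots> = (\<integral>\<^sup>+\<omega>. (?b \<omega> * \<rho> (obs X L \<omega>)) * indicator (- N) (obs X L \<omega>) \<partial>M')"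
      by (simp add: mult_ac)
    also have "\<dots> = (\<integral>\<^sup>+\<omega>. (?b \<omega> * \<rho> (obs X L \<omega>)) * \<delta> (obs X L \<omega>) \<partial>M)"
      by (rule \<delta>_int[of "\<lambda>z. indicator B (restrict z {(a, t)}) * \<rho> z"]) measurable
    also have "\<dots> = (\<integral>\<^sup>+\<omega>. (?b \<omega> * \<delta> (obs X L \<omega>)) * \<rho> (obs X L \<omega>) \<partial>M)"
      by (simp add: mult_ac)
    also have "\<dots> = (\<integral>\<^sup>+\<omega>. (?b \<omega> * \<delta> (obs X L \<omega>)) * indicator A (obs X I \<omega>) \<partial>M)"
      by (rule key[OF ts(1) ci(1) \<kappa>, symmetric, of "\<lambda>z. indicator B (restrict z {(a, t)}) * \<delta> z"]) measurable
    also have "\<dots> = emeasure ?\<nu> D"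
      unfolding em[OF ts(1) \<delta>_meas D_meas] ind by (simp add: mult_ac)
    finally show "emeasure ?\<nu>' D = emeasure ?\<nu> D" .
  qed
  have "(\<integral>\<^sup>+\<omega>. f (obs X ?J \<omega>) * indicator (- N) (obs X L \<omega>) \<partial>M') = (\<integral>\<^sup>+\<omega>. f (obs X ?J \<omega>) * \<delta> (obs X L \<omega>) \<partial>M)"
    if [measurable]: "f \<in> borel_measurable (path_space ?J)" for f
  proof -
    have "(\<integral>\<^sup>+x. f x \<partial>?\<nu>') = (\<integral>\<^sup>+\<omega>. indicator (- N) (obs X L \<omega>) * f (obs X ?J \<omega>) \<partial>M')"
      by (subst nn_integral_distr, measurable, rule nn_integral_density, measurable)
    moreover have "(\<integral>\<^sup>+x. f x \<partial>?\<nu>) = (\<integral>\<^sup>+\<omega>. \<delta> (obs X L \<omega>) * f (obs X ?J \<omega>) \<partial>M)"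
      by (subst nn_integral_distr, measurable, rule nn_integral_density, measurable)
    ultimately show ?thesis unfolding \<nu>_eq by (simp only: mult.commute[of "f _"])
  qed
  then show ?thesis using \<delta>_meas by blast
qed

text \<open>Off \<open>N\<close> the common kernel \<open>\<kappa>V\<close> may be replaced by
  \<open>\<kappa>J\<close>, which depends on \<open>obs X J\<close> only; then the density
  \<open>\<delta>\<close> carries the integral to the idle law. There \<open>\<delta>\<close> is a
  function of \<open>obs X L\<close>, so \<open>\<kappa>J\<close> may be exchanged for
  \<open>\<kappa>L\<close>, and \<open>\<delta>\<close> carries the integral back.\<close>

lemma regime_invariance_off_exception:
  fixes X :: "'v \<Rightarrow> int \<Rightarrow> 'w \<Rightarrow> real" and Y :: "'w \<Rightarrow> real"
  assumes ts: "time_series M X" "time_series M' X" and sub: "L \<subseteq> J" "J \<subseteq> V"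
    and Y: "Y \<in> borel_measurable M" "Y \<in> borel_measurable M'"
    and \<kappa>J: "cond_dist M Y borel (obs X J) (path_space J) \<kappa>J"
    and \<kappa>J_V: "cond_dist M Y borel (obs X V) (path_space V) (\<lambda>z. \<kappa>J (restrict z J))"
    and \<kappa>L: "cond_dist M Y borel (obs X L) (path_space L) \<kappa>L"
    and \<kappa>V: "cond_dist M Y borel (obs X V) (path_space V) \<kappa>V" "cond_dist M' Y borel (obs X V) (path_space V) \<kappa>V"
    and ovl: "\<forall>E\<in>sets (path_space V). (AE \<omega> in M. obs X V \<omega> \<notin> E) \<longrightarrow>
        (AE \<omega> in M'. obs X V \<omega> \<in> E \<longrightarrow> obs X L \<omega> \<in> N)"
    and \<delta>: "\<delta> \<in> borel_measurable (path_space L)"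
      "\<forall>f\<in>borel_measurable (path_space J).
        (\<integral>\<^sup>+\<omega>. f (obs X J \<omega>) * indicator (- N) (obs X L \<omega>) \<partial>M') = (\<integral>\<^sup>+\<omega>. f (obs X J \<omega>) * \<delta> (obs X L \<omega>) \<partial>M)"
    and A: "A \<in> sets borel" and C: "C \<in> sets (path_space L)" "C \<inter> N = {}"
  shows "emeasure M' {\<omega> \<in> space M'. Y \<omega> \<in> A \<and> obs X L \<omega> \<in> C} =
    (\<integral>\<^sup>+\<omega>. emeasure (\<kappa>L (obs X L \<omega>)) A * indicator C (obs X L \<omega>) \<partial>M')"
proof -
  interpret M: prob_space M using ts by (simp add: time_series_def)
  interpret M': prob_space M' using ts by (simp add: time_series_def)
  note [measurable] = measurable_obs[OF ts(1)] measurable_obs[OF ts(2)] Y A C(1) \<delta>(1)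
  have \<kappa>J_meas: "\<kappa>J \<in> path_space J \<rightarrow>\<^sub>M prob_algebra borel"
    and \<kappa>V_meas: "\<kappa>V \<in> path_space V \<rightarrow>\<^sub>M prob_algebra borel"
    and \<kappa>L_meas: "\<kappa>L \<in> path_space L \<rightarrow>\<^sub>M prob_algebra borel"
    using \<kappa>J \<kappa>V \<kappa>L by (auto simp: cond_dist_def)
  note [measurable] = kernel_emeasure_measurable[OF \<kappa>J_meas A] kernel_emeasure_measurable[OF \<kappa>V_meas A]
    kernel_emeasure_measurable[OF \<kappa>L_meas A]
  have r[measurable]: "(\<lambda>z. restrict z J) \<in> path_space V \<rightarrow>\<^sub>M path_space J"
    "(\<lambda>z. restrict z L) \<in> path_space V \<rightarrow>\<^sub>M path_space L" "(\<lambda>z. restrict z L) \<in> path_space J \<rightarrow>\<^sub>M path_space L"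
    using sub by (auto intro!: measurable_restrict_subset)
  have restr: "restrict (obs X V \<omega>) J = obs X J \<omega>" "restrict (obs X V \<omega>) L = obs X L \<omega>" "restrict (obs X J \<omega>) L = obs X L \<omega>" for \<omega>
    using sub by (auto intro!: restrict_obs)
  \<comment> \<open>The histories on which the two versions disagree are null in the idle regime;
    overlap then confines them to \<open>N\<close>, almost surely under the intervention.\<close>
  let ?E = "{z \<in> space (path_space V). measure (\<kappa>V z) A \<noteq> measure (\<kappa>J (restrict z J)) A}"
  have "(\<lambda>z. measure (\<kappa>J (restrict z J)) A) \<in> borel_measurable (path_space V)"
    by (rule measurable_compose[OF r(1) kernel_emeasure_measurable(2)[OF \<kappa>J_meas A]])
  then have E: "?E \<in> sets (path_space V)"
    by (rule borel_measurable_neq[OF kernel_emeasure_measurable(2)[OF \<kappa>V_meas A]])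
  have "AE \<omega> in M. measure (\<kappa>V (obs X V \<omega>)) A = measure (\<kappa>J (restrict (obs X V \<omega>) J)) A"
    using \<kappa>V(1)[unfolded cond_dist_def, THEN conjunct2, rule_format, OF A]
      \<kappa>J_V[unfolded cond_dist_def, THEN conjunct2, rule_format, OF A] by eventually_elim simp
  then have "AE \<omega> in M. obs X V \<omega> \<notin> ?E" by eventually_elim simp
  from ovl[rule_format, OF E this] have "AE \<omega> in M'. obs X L \<omega> \<in> C \<longrightarrow> measure (\<kappa>V (obs X V \<omega>)) A = measure (\<kappa>J (obs X J \<omega>)) A"
  proof eventually_elim
    case (elim \<omega>)
    then show ?case using C(2) obs_in_path_space[of X V \<omega>] by (auto simp: restr)
  qed
  then have agree: "AE \<omega> in M'. obs X L \<omega> \<in> C \<longrightarrow> emeasure (\<kappa>V (obs X V \<omega>)) A = emeasure (\<kappa>J (obs X J \<omega>)) A"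
  proof eventually_elim
    case (elim \<omega>)
    have "finite_measure (\<kappa>V (obs X V \<omega>))" "finite_measure (\<kappa>J (obs X J \<omega>))"
      by (rule prob_space.finite_measure, rule kernel_prob_space(1)[OF _ obs_in_path_space], fact)+
    then show ?case using elim by (simp add: finite_measure.emeasure_eq_measure)
  qed
  have N: "indicator C (obs X L \<omega>) * indicator (- N) (obs X L \<omega>) = (indicator C (obs X L \<omega>) :: ennreal)" for \<omega>
    using C(2) by (auto simp: indicator_def)
  let ?c = "\<lambda>\<omega>. indicator C (obs X L \<omega>) :: ennreal" and ?n = "\<lambda>\<omega>. indicator (- N) (obs X L \<omega>) :: ennreal"
  have "emeasure M' {\<omega> \<in> space M'. Y \<omega> \<in> A \<and> obs X L \<omega> \<in> C} =
      (\<integral>\<^sup>+\<omega>. indicator {\<omega> \<in> space M'. Y \<omega> \<in> A \<and> obs X L \<omega> \<in> C} \<omega> \<partial>M')"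
    by simp
  also have "\<dots> = (\<integral>\<^sup>+\<omega>. indicator C (restrict (obs X V \<omega>) L) * indicator A (Y \<omega>) \<partial>M')"
    by (rule nn_integral_cong) (auto simp: indicator_def restr)
  also have "\<dots> = (\<integral>\<^sup>+\<omega>. indicator C (restrict (obs X V \<omega>) L) * emeasure (\<kappa>V (obs X V \<omega>)) A \<partial>M')"
    by (rule M'.cond_dist_nn_integral[OF \<kappa>V(2) Y(2)]) measurable
  also have "\<dots> = (\<integral>\<^sup>+\<omega>. (?c \<omega> * emeasure (\<kappa>J (obs X J \<omega>)) A) * ?n \<omega> \<partial>M')"
  proof (rule nn_integral_cong_AE)
    show "AE \<omega> in M'. indicator C (restrict (obs X V \<omega>) L) * emeasure (\<kappa>V (obs X V \<omega>)) A =
        (?c \<omega> * emeasure (\<kappa>J (obs X J \<omega>)) A) * ?n \<omega>"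
      using agree
    proof eventually_elim
      case (elim \<omega>)
      then show ?case using C(2) by (auto simp: indicator_def restr)
    qed
  qed
  also have "\<dots> = (\<integral>\<^sup>+\<omega>. (?c \<omega> * emeasure (\<kappa>J (obs X J \<omega>)) A) * \<delta> (obs X L \<omega>) \<partial>M)"
    using bspec[OF \<delta>(2), of "\<lambda>z. indicator C (restrict z L) * emeasure (\<kappa>J z) A"] by (simp add: restr)
  also have "\<dots> = (\<integral>\<^sup>+\<omega>. (indicator C (restrict (obs X J \<omega>) L) * \<delta> (restrict (obs X J \<omega>) L)) * emeasure (\<kappa>J (obs X J \<omega>)) A \<partial>M)"
    by (simp add: restr mult_ac)
  also have "\<dots> = (\<integral>\<^sup>+\<omega>. (indicator C (restrict (obs X J \<omega>) L) * \<delta> (restrict (obs X J \<omega>) L)) * indicator A (Y \<omega>) \<partial>M)"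
    by (rule M.cond_dist_nn_integral[OF \<kappa>J Y(1), symmetric]) measurable
  also have "\<dots> = (\<integral>\<^sup>+\<omega>. (indicator C (obs X L \<omega>) * \<delta> (obs X L \<omega>)) * indicator A (Y \<omega>) \<partial>M)"
    by (simp add: restr)
  also have "\<dots> = (\<integral>\<^sup>+\<omega>. (indicator C (obs X L \<omega>) * \<delta> (obs X L \<omega>)) * emeasure (\<kappa>L (obs X L \<omega>)) A \<partial>M)"
    by (rule M.cond_dist_nn_integral[OF \<kappa>L Y(1)]) measurable
  also have "\<dots> = (\<integral>\<^sup>+\<omega>. (?c \<omega> * emeasure (\<kappa>L (obs X L \<omega>)) A) * \<delta> (obs X L \<omega>) \<partial>M)"
    by (simp add: mult_ac)
  also have "\<dots> = (\<integral>\<^sup>+\<omega>. (?c \<omega> * emeasure (\<kappa>L (obs X L \<omega>)) A) * ?n \<omega> \<partial>M')"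
    using bspec[OF \<delta>(2), of "\<lambda>z. indicator C (restrict z L) * emeasure (\<kappa>L (restrict z L)) A"] by (simp add: restr)
  also have "\<dots> = (\<integral>\<^sup>+\<omega>. emeasure (\<kappa>L (obs X L \<omega>)) A * ?c \<omega> \<partial>M')"
    by (rule nn_integral_cong) (use C(2) in \<open>auto simp: indicator_def\<close>)
  finally show ?thesis .
qed

text \<open>\<open>N\<close> is the event that component \<open>a\<close> takes the prescribed value
  at time \<open>t\<close>. It can be read off the history of \<open>S\<close> up to
  \<open>t\<close> because \<open>a \<in> S\<close> and \<open>C \<subseteq> S\<close>; absolute
  continuity makes it null in the idle regime and the point mass makes it almost sure under the
  intervention.\<close>

lemma prescribed_value_exception:
  fixes X :: "'v::finite \<Rightarrow> int \<Rightarrow> 'w \<Rightarrow> real"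
  assumes ts: "time_series M X" "time_series M' X" and ac: "ac_conditionals M X"
    and g: "g \<in> borel_measurable (path_space (C \<times> {..t - 1}))" and CS: "C \<subseteq> S" and aS: "a \<in> S"
    and cl: "cond_law_given_past M' X a t (\<lambda>p. return borel (g (restrict p (C \<times> {..t - 1}))))"
  obtains N where "N \<in> sets (path_space (S \<times> {..t}))"
    "AE \<omega> in M. obs X (S \<times> {..t}) \<omega> \<notin> N" "AE \<omega> in M'. obs X (S \<times> {..t}) \<omega> \<in> N"
proof -
  let ?C = "C \<times> {..t - 1}" and ?V = "UNIV \<times> {..t - 1}" and ?S = "S \<times> {..t}"
  let ?g = "\<lambda>p. g (restrict p ?C)"
  have sub: "?C \<subseteq> ?V" "?C \<subseteq> ?S" "(a, t) \<in> ?S" using CS aS by auto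
  have gV: "?g \<in> borel_measurable (path_space ?V)"
    by (rule measurable_compose[OF measurable_restrict_subset[OF sub(1)] g])
  have gS[measurable]: "?g \<in> borel_measurable (path_space ?S)"
    by (rule measurable_compose[OF measurable_restrict_subset[OF sub(2)] g])
  have [measurable]: "(\<lambda>z. z (a, t)) \<in> borel_measurable (path_space ?S)"
    by (rule measurable_component_singleton[OF sub(3)])
  let ?N = "{z \<in> space (path_space ?S). z (a, t) = ?g z}"
  have N: "?N \<in> sets (path_space ?S)" by measurable
  have *: "obs X ?S \<omega> \<in> ?N \<longleftrightarrow> X a t \<omega> = ?g (obs X ?V \<omega>)" for \<omega>
    using obs_in_path_space[of X ?S \<omega>] sub(3) by (simp add: obs_apply restrict_obs[OF sub(1)] restrict_obs[OF sub(2)])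
  have "AE \<omega> in M. obs X ?S \<omega> \<notin> ?N"
    unfolding * by (rule ac_conditionals_avoid_function_of_past[OF ts(1) ac gV])
  moreover have "AE \<omega> in M'. obs X ?S \<omega> \<in> ?N"
    unfolding * by (rule cond_law_point_mass[OF ts(2) gV cl])
  ultimately show ?thesis using that N by blast
qed

theorem theorem4p11:
  fixes P :: "'v::finite regime \<Rightarrow> 'w measure"
    and X :: "'v \<Rightarrow> int \<Rightarrow> 'w \<Rightarrow> real"
    and G :: "'v mixed_graph"
    and a b :: 'v and S :: "'v set" and t :: int
    and s :: "'v intervention"
  assumes "mixed_graph G"
    and "time_series (P Idle) X" and "time_series (P (Do s)) X"
    and "stationary (P Idle) X" and "mixing (P Idle) X" and "ac_conditionals (P Idle) X"
    and "global_granger_markov (P Idle) X G"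
    and "a \<in> S" and "b \<in> S"
    and "intervened (P (Do s)) X a t s"
    and overlap: "\<And>C q. s = Random C q \<Longrightarrow> overlap (P Idle) (P (Do s)) X S t"
    and cond1: "indep_regime P {Idle, Do s}
          (obs X (UNIV \<times> {..t - 1} \<union> (- {a}) \<times> {t})) (path_space (UNIV \<times> {..t - 1} \<union> (- {a}) \<times> {t}))"
    and cond2: "cond_indep_regime P {Idle, Do s}
          (obs X (UNIV \<times> {t<..})) (path_space (UNIV \<times> {t<..}))
          (obs X (UNIV \<times> {..t})) (path_space (UNIV \<times> {..t}))"
    and cond3: "depends_on s \<subseteq> S"
    and blocked: "\<And>v es. v \<in> an G b \<Longrightarrow> is_path G a es v \<Longrightarrow> pointing es \<Longrightarrow> back_door es \<Longrightarrow>
          m_blocked S es"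
  shows "\<forall>h::nat. h \<ge> 1 \<longrightarrow>
           cond_indep_regime P {Idle, Do s}
             (X b (t + int h)) borel (obs X (S \<times> {..t})) (path_space (S \<times> {..t}))"
proof (intro allI impI)
  fix h :: nat assume h: "h \<ge> 1"
  let ?M = "P Idle" and ?M' = "P (Do s)"
  note ts = assms(2,3)
  interpret M: prob_space ?M using ts by (simp add: time_series_def)
  interpret M': prob_space ?M' using ts by (simp add: time_series_def)
  define Y where "Y = X b (t + int h)"
  have Y: "Y \<in> borel_measurable ?M" "Y \<in> borel_measurable ?M'"
    using ts by (auto simp: Y_def time_series_def)
  define L where "L = S \<times> {..t}"
  note obs = measurable_obs[OF ts(1)] measurable_obs[OF ts(2)]
  obtain \<kappa> where \<kappa>: "cond_dist ?M Y borel (obs X L) (path_space L) \<kappa>"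
    using M.cond_dist_exists[OF Y(1) obs(1)] .
  obtain \<kappa>' where \<kappa>': "cond_dist ?M' Y borel (obs X L) (path_space L) \<kappa>'"
    using M'.cond_dist_exists[OF Y(2) obs(2)] .
  have regimeI: "cond_indep_regime P {Idle, Do s} Y borel (obs X L) (path_space L)"
    if "cond_dist ?M Y borel (obs X L) (path_space L) \<kappa>''" "cond_dist ?M' Y borel (obs X L) (path_space L) \<kappa>''" for \<kappa>''
    using that by (auto simp: cond_indep_regime_def)
  \<comment> \<open>The common version is the interventional one on \<open>N\<close> and the idle
    one elsewhere; changing the idle kernel on \<open>N\<close> is harmless when \<open>N\<close> is
    null in the idle regime.\<close>
  have glued: "(\<lambda>z. if z \<in> N then \<kappa>' z else \<kappa> z) \<in> path_space L \<rightarrow>\<^sub>M prob_algebra borel"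
    if "N \<in> sets (path_space L)" for N
    using \<kappa> \<kappa>' that by (intro measurable_If_set) (auto simp: cond_dist_def)
  have glued_idle: "cond_dist ?M Y borel (obs X L) (path_space L) (\<lambda>z. if z \<in> N then \<kappa>' z else \<kappa> z)"
    if "N \<in> sets (path_space L)" "AE \<omega> in ?M. obs X L \<omega> \<notin> N" for N
    using that(2) by (intro cond_dist_cong_AE[OF \<kappa> glued[OF that(1)]]) auto
  have prescribed: "cond_indep_regime P {Idle, Do s} Y borel (obs X L) (path_space L)"
    if g: "g \<in> borel_measurable (path_space (C \<times> {..t - 1}))" "C \<subseteq> S"
      and cl: "cond_law_given_past ?M' X a t (\<lambda>p. return borel (g (restrict p (C \<times> {..t - 1}))))" for g C
  proof -
    obtain N where N: "N \<in> sets (path_space L)" "AE \<omega> in ?M. obs X L \<omega> \<notin> N" "AE \<omega> in ?M'. obs X L \<omega> \<in> N"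
      using prescribed_value_exception[OF ts assms(6) g \<open>a \<in> S\<close> cl] unfolding L_def .
    have "cond_dist ?M' Y borel (obs X L) (path_space L) (\<lambda>z. if z \<in> N then \<kappa>' z else \<kappa> z)"
      using N(3) by (intro cond_dist_cong_AE[OF \<kappa>' glued[OF N(1)]]) auto
    then show ?thesis by (rule regimeI[OF glued_idle[OF N(1,2)]])
  qed
  have "cond_indep_regime P {Idle, Do s} Y borel (obs X L) (path_space L)"
  proof (cases s)
    case (Atomic x)
    \<comment> \<open>An atomic intervention is a conditional one with a constant function of no
      components.\<close>
    then have "cond_law_given_past ?M' X a t (\<lambda>p. return borel x)" using assms(10) by simp
    then show ?thesis by (intro prescribed[of "\<lambda>_. x" "{}"]) auto
  next
    case (Conditional C g)
    then have "g \<in> borel_measurable (path_space (C \<times> {..t - 1}))" "C \<subseteq> S"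
      "cond_law_given_past ?M' X a t (\<lambda>p. return borel (g (restrict p (C \<times> {..t - 1}))))"
      using assms(10) cond3 by simp_all
    then show ?thesis by (rule prescribed)
  next
    case (Random C q)
    define U where "U = an G b - S"
    \<comment> \<open>\<open>K\<close> is the history of \<open>S\<close> without the intervened
      variable; \<open>I\<close> adds the ancestors of \<open>b\<close> outside \<open>S\<close>.
      Neither contains \<open>(a, t)\<close>, so condition (1) makes the law of
      \<open>obs X I\<close> the same in both regimes.\<close>
    define K where "K = S \<times> {..t - 1} \<union> (S - {a}) \<times> {t}"
    define I where "I = U \<times> {..t} \<union> K"
    define V where "V = (UNIV :: 'v set) \<times> {..t}"
    have L: "L = K \<union> {(a, t)}" using \<open>a \<in> S\<close> by (auto simp: L_def K_def)
    have J: "I \<union> {(a, t)} = U \<times> {..t} \<union> L" by (auto simp: I_def L)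
    have aU: "a \<notin> U" using \<open>a \<in> S\<close> by (simp add: U_def)
    have "cond_indep ?M X {(a, t)} (U \<times> {..t}) K"
      unfolding U_def K_def using blocked
      by (intro cond_indep_back_door[OF ts(1) assms(1,7) \<open>a \<in> S\<close> \<open>b \<in> S\<close>]) blast
    then have ci: "cond_indep ?M X I {(a, t)} K"
      by (rule cond_indep_sym[OF cond_indep_between[OF ts(1)]]) (auto simp: I_def)
    have "cond_indep ?M' X {(a, t)} (U \<times> {..t}) K"
      unfolding K_def using assms(10) cond3 Random aU \<open>a \<in> S\<close>
      by (intro intervened_Random_cond_indep[OF ts(2), of _ _ C q]) auto
    then have ci': "cond_indep ?M' X I {(a, t)} K"
      by (rule cond_indep_sym[OF cond_indep_between[OF ts(2)]]) (auto simp: I_def)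
    define W where "W = (UNIV :: 'v set) \<times> {..t - 1} \<union> (- {a}) \<times> {t}"
    have IW: "I \<subseteq> W" using aU by (auto simp: I_def K_def W_def)
    have law: "distr ?M (path_space I) (obs X I) = distr ?M' (path_space I) (obs X I)"
    proof -
      have "distr Q (path_space I) (obs X I) = distr (distr Q (path_space W) (obs X W)) (path_space I) (\<lambda>z. restrict z I)"
        if "time_series Q X" for Q
        by (subst distr_distr[OF measurable_restrict_subset[OF IW] measurable_obs[OF that]])
          (simp add: comp_def restrict_obs[OF IW])
      moreover have "distr ?M (path_space W) (obs X W) = distr ?M' (path_space W) (obs X W)"
        using cond1 unfolding indep_regime_def W_def by blast
      ultimately show ?thesis using ts by simp
    qed
    have "\<exists>N\<in>sets (path_space L). (AE \<omega> in ?M. obs X L \<omega> \<notin> N) \<and>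
        (\<forall>E\<in>sets (path_space V). (AE \<omega> in ?M. obs X V \<omega> \<notin> E) \<longrightarrow>
          (AE \<omega> in ?M'. obs X V \<omega> \<in> E \<longrightarrow> obs X L \<omega> \<in> N))"
      using overlap[OF Random] unfolding overlap_def L_def V_def .
    then obtain N where N: "N \<in> sets (path_space L)" "AE \<omega> in ?M. obs X L \<omega> \<notin> N"
      and ovl: "\<forall>E\<in>sets (path_space V). (AE \<omega> in ?M. obs X V \<omega> \<notin> E) \<longrightarrow>
          (AE \<omega> in ?M'. obs X V \<omega> \<in> E \<longrightarrow> obs X L \<omega> \<in> N)"
      by (elim bexE conjE)
    have LV: "L \<subseteq> V" and JV: "I \<union> {(a, t)} \<subseteq> V" and LJ: "L \<subseteq> I \<union> {(a, t)}"
      and AJ: "an G b \<times> {..t} \<subseteq> I \<union> {(a, t)}"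
      unfolding J by (auto simp: L_def V_def U_def)
    \<comment> \<open>A null event about \<open>obs X L\<close> is lifted to a cylinder event about
      the full history, to which overlap applies.\<close>
    have ovl_L: "\<forall>C\<in>sets (path_space L). (AE \<omega> in ?M. obs X L \<omega> \<notin> C) \<longrightarrow>
        (AE \<omega> in ?M'. obs X L \<omega> \<in> C \<longrightarrow> obs X L \<omega> \<in> N)"
    proof (intro ballI impI)
      fix C assume C: "C \<in> sets (path_space L)" "AE \<omega> in ?M. obs X L \<omega> \<notin> C"
      let ?E = "(\<lambda>z. restrict z L) -` C \<inter> space (path_space V)"
      have E: "?E \<in> sets (path_space V)"
        by (rule measurable_sets[OF measurable_restrict_subset[OF LV] C(1)])
      have *: "obs X V \<omega> \<in> ?E \<longleftrightarrow> obs X L \<omega> \<in> C" for \<omega>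
        using obs_in_path_space[of X V \<omega>] by (simp add: restrict_obs[OF LV])
      have "AE \<omega> in ?M. obs X V \<omega> \<notin> ?E" unfolding * by (rule C(2))
      from ovl[rule_format, OF E this] show "AE \<omega> in ?M'. obs X L \<omega> \<in> C \<longrightarrow> obs X L \<omega> \<in> N"
        unfolding * .
    qed
    have KI: "K \<subseteq> I" by (simp add: I_def)
    obtain \<delta> where \<delta>: "\<delta> \<in> borel_measurable (path_space L)"
      "\<forall>f\<in>borel_measurable (path_space (I \<union> {(a, t)})).
        (\<integral>\<^sup>+\<omega>. f (obs X (I \<union> {(a, t)}) \<omega>) * indicator (- N) (obs X L \<omega>) \<partial>?M') =
        (\<integral>\<^sup>+\<omega>. f (obs X (I \<union> {(a, t)}) \<omega>) * \<delta> (obs X L \<omega>) \<partial>?M)"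
      using regime_density[OF ts KI L ci ci' law N(1) ovl_L] by (elim bexE)
    obtain \<kappa>J where \<kappa>J: "cond_dist ?M Y borel (obs X (I \<union> {(a, t)})) (path_space (I \<union> {(a, t)})) \<kappa>J"
      using M.cond_dist_exists[OF Y(1) obs(1)] .
    have "cond_indep ?M X (an G b \<times> {t<..t + int h}) V (an G b \<times> {..t})"
      unfolding V_def by (rule cond_indep_future_ancestors[OF ts(1) assms(7)])
    then have "cond_indep ?M X (an G b \<times> {t<..t + int h}) V (I \<union> {(a, t)})"
      by (rule cond_indep_between[OF ts(1) _ _ AJ]) (use JV in auto)
    \<comment> \<open>The index \<open>(b, t + int h)\<close> lies in the future of the ancestors,
      as \<open>b\<close> is its own ancestor and \<open>h \<ge> 1\<close>.\<close>
    moreover have "Y \<in> borel_measurable (info ?M X (an G b \<times> {t<..t + int h}))"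
      unfolding Y_def using h by (intro borel_measurable_info_component) (auto simp: an_def)
    moreover have "V = V \<union> (I \<union> {(a, t)})" using JV by blast
    ultimately have \<kappa>J_V: "cond_dist ?M Y borel (obs X V) (path_space V) (\<lambda>z. \<kappa>J (restrict z (I \<union> {(a, t)})))"
      using cond_dist_of_cond_indep[OF ts(1) _ _ \<kappa>J] by blast
    \<comment> \<open>Condition (2) yields one kernel for the entire future that is valid in both
      regimes; its marginal at \<open>(b, t + int h)\<close> is the common kernel for
      \<open>Y\<close>.\<close>
    obtain \<kappa>V where \<kappa>V: "cond_dist (P r) (obs X (UNIV \<times> {t<..})) (path_space (UNIV \<times> {t<..})) (obs X V) (path_space V) \<kappa>V"
      if "r \<in> {Idle, Do s}" for r
      using cond2 unfolding cond_indep_regime_def V_def by blast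
    have bF: "(b, t + int h) \<in> UNIV \<times> {t<..}" using h by simp
    have \<kappa>Y: "cond_dist (P r) Y borel (obs X V) (path_space V) (\<lambda>z. distr (\<kappa>V z) borel (\<lambda>x. x (b, t + int h)))"
      if r: "r \<in> {Idle, Do s}" for r
    proof -
      have tsr: "time_series (P r) X" using r ts by auto
      show ?thesis
        using cond_dist_compose[OF \<kappa>V[OF r] measurable_obs[OF tsr] measurable_obs[OF tsr] measurable_component_singleton[OF bF]]
        by (simp add: obs_apply[OF bF] Y_def)
    qed
    have "cond_dist ?M' Y borel (obs X L) (path_space L) (\<lambda>z. if z \<in> N then \<kappa>' z else \<kappa> z)"
    proof (rule M'.cond_dist_glue[OF \<kappa>' _ Y(2) obs(2) N(1)])
      show "\<kappa> \<in> path_space L \<rightarrow>\<^sub>M prob_algebra borel" using \<kappa> by (simp add: cond_dist_def)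
      fix A C assume "A \<in> sets (borel :: real measure)" "C \<in> sets (path_space L)" "C \<inter> N = {}"
      then show "emeasure ?M' {\<omega> \<in> space ?M'. Y \<omega> \<in> A \<and> obs X L \<omega> \<in> C} =
          (\<integral>\<^sup>+\<omega>. emeasure (\<kappa> (obs X L \<omega>)) A * indicator C (obs X L \<omega>) \<partial>?M')"
        by (rule regime_invariance_off_exception[OF ts LJ JV Y \<kappa>J \<kappa>J_V \<kappa>
              \<kappa>Y[OF insertI1] \<kappa>Y[OF insertI2[OF singletonI]] ovl \<delta>])
    qed
    then show ?thesis by (rule regimeI[OF glued_idle[OF N]])
  qed
  then show "cond_indep_regime P {Idle, Do s} (X b (t + int h)) borel (obs X (S \<times> {..t})) (path_space (S \<times> {..t}))"
    unfolding Y_def L_def .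
qed

end
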